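(* Let $\Omega\subset\mathbb R^2$ be a bounded Lipschitz domain and let $m\colon\Omega\to\mathbb R^2$ satisfy $|m|=1$ a.e. in $\Omega$ and $\nabla\cdot m=0$ in $\mathcal D'(\Omega)$. Assume that $\nabla\cdot\Sigma_{\alpha_1,\alpha_2}(m)\in\mathcal M_{\mathrm{loc}}(\Omega)$ for $(\alpha_1,\alpha_2)=(e_1,e_2)$ and for $(\alpha_1,\alpha_2)=(\varepsilon_1,\varepsilon_2)$. Then $m\in B^s_{4,\infty,\mathrm{loc}}(\Omega)$ for every $s<\frac14$.
   Context: $(e_1,e_2)$ is the standard basis of $\mathbb R^2$, $\varepsilon_1=\frac{e_1+e_2}{\sqrt2}$, $\varepsilon_2=\frac{-e_1+e_2}{\sqrt2}$. For an orthonormal frame $(\alpha_1,\alpha_2)$, $$\Sigma_{\alpha_1,\alpha_2}(z)=\frac43\big((z\cdot\alpha_2)^3\alpha_1+(z\cdot\alpha_1)^3\alpha_2\big),\qquad z\in\mathbb R^2.$$ $\mathcal M_{\mathrm{loc}}(\Omega)$ denotes locally finite Radon measures. For $0<s<1$, $f\in B^s_{4,\infty}(U)$ means $\|f\|_{L^4(U)}+\sup_{0<t\le1}t^{-s}\sup_{|z|\le t}\|D^zf\|_{L^4(U)}<\infty$, where $D^zf(x)=f(x+z)-f(x)$ if $x,x+z\in U$ and $0$ otherwise; $B^s_{4,\infty,\mathrm{loc}}(\Omega)=\bigcap_{U\subset\subset\Omega}B^s_{4,\infty}(U)$. *)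

theory Defs
  imports "HOL-Analysis.Analysis"
begin

(* Functions on a subset of the plane are total functions; every definition below only
   looks at their values on the relevant open set. *)

(* Open, connected, nonempty, bounded, and near each boundary point equal, after a rigid motion
   of the coordinate axes, to the region above the graph of a Lipschitz function. *)
definition bounded_lipschitz_domain :: "(real^2) set \<Rightarrow> bool" where
  "bounded_lipschitz_domain \<Omega> \<longleftrightarrow>
     open \<Omega> \<and> connected \<Omega> \<and> \<Omega> \<noteq> {} \<and> bounded \<Omega> \<and>
     (\<forall>p\<in>frontier \<Omega>. \<exists>r>0. \<exists>a b. norm a = 1 \<and> norm b = 1 \<and> a \<bullet> b = 0 \<and>
        (\<exists>L. \<exists>\<gamma>::real \<Rightarrow> real. L-lipschitz_on UNIV \<gamma> \<and>
           \<Omega> \<inter> ball p r = {x \<in> ball p r. x \<bullet> b > \<gamma> (x \<bullet> a)}))"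

definition partial_deriv :: "2 \<Rightarrow> (real^2 \<Rightarrow> real) \<Rightarrow> real^2 \<Rightarrow> real" where
  "partial_deriv i f x = frechet_derivative f (at x) (axis i 1)"

definition grad :: "(real^2 \<Rightarrow> real) \<Rightarrow> real^2 \<Rightarrow> real^2" where
  "grad f x = (\<chi> i. partial_deriv i f x)"

primrec Ck :: "nat \<Rightarrow> (real^2 \<Rightarrow> real) \<Rightarrow> bool" where
  "Ck 0 f \<longleftrightarrow> continuous_on UNIV f"
| "Ck (Suc k) f \<longleftrightarrow> (\<forall>x. f differentiable (at x)) \<and> (\<forall>i. Ck k (partial_deriv i f))"

(* Test functions on \<Omega>, identified with their extension by zero to the whole plane. *)
definition test_functions :: "(real^2) set \<Rightarrow> (real^2 \<Rightarrow> real) set" where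
  "test_functions \<Omega> =
     {\<phi>. (\<forall>k. Ck k \<phi>) \<and> compact (closure {x. \<phi> x \<noteq> 0}) \<and> closure {x. \<phi> x \<noteq> 0} \<subseteq> \<Omega>}"

(* Distributional divergence of a locally integrable vector field F on \<Omega>; distributions are
   represented by their action on test functions. *)
definition distr_div ::
  "(real^2) set \<Rightarrow> (real^2 \<Rightarrow> real^2) \<Rightarrow> (real^2 \<Rightarrow> real) \<Rightarrow> real" where
  "distr_div \<Omega> F \<phi> = - (LINT x|lebesgue_on \<Omega>. F x \<bullet> grad \<phi> x)"

definition positive_radon :: "(real^2) set \<Rightarrow> (real^2) measure \<Rightarrow> bool" where
  "positive_radon \<Omega> \<mu> \<longleftrightarrow> sets \<mu> = sets (restrict_space borel \<Omega>) \<and>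
     (\<forall>K. compact K \<longrightarrow> K \<subseteq> \<Omega> \<longrightarrow> emeasure \<mu> K < \<infinity>)"

(* The distributions on \<Omega> that are given by a locally finite signed Radon measure.  Such a measure
   need not be defined on all Borel sets (its positive and negative parts may both be infinite), so
   it is represented as a difference of two positive ones; Borel measures that are finite on compact
   subsets of an open set of the plane are automatically regular. *)
definition M_loc :: "(real^2) set \<Rightarrow> ((real^2 \<Rightarrow> real) \<Rightarrow> real) set" where
  "M_loc \<Omega> = {T. \<exists>\<mu> \<nu>. positive_radon \<Omega> \<mu> \<and> positive_radon \<Omega> \<nu> \<and>
     (\<forall>\<phi>\<in>test_functions \<Omega>. T \<phi> = (LINT x|\<mu>. \<phi> x) - (LINT x|\<nu>. \<phi> x))}"

definition Sigma_field :: "real^2 \<Rightarrow> real^2 \<Rightarrow> real^2 \<Rightarrow> real^2" where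
  "Sigma_field \<alpha>1 \<alpha>2 z = (4/3) *\<^sub>R ((z \<bullet> \<alpha>2)^3 *\<^sub>R \<alpha>1 + (z \<bullet> \<alpha>1)^3 *\<^sub>R \<alpha>2)"

definition e1 :: "real^2" where "e1 = axis 1 1"
definition e2 :: "real^2" where "e2 = axis 2 1"
definition eps1 :: "real^2" where "eps1 = (1 / sqrt 2) *\<^sub>R (e1 + e2)"
definition eps2 :: "real^2" where "eps2 = (1 / sqrt 2) *\<^sub>R (- e1 + e2)"

definition L4_norm :: "(real^2) set \<Rightarrow> (real^2 \<Rightarrow> real^2) \<Rightarrow> ennreal" where
  "L4_norm U f = (let I = (\<integral>\<^sup>+ x. ennreal (norm (f x) ^ 4) \<partial>lebesgue_on U)
                  in if I = \<infinity> then \<infinity> else ennreal (root 4 (enn2real I)))"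

definition finite_diff ::
  "(real^2) set \<Rightarrow> real^2 \<Rightarrow> (real^2 \<Rightarrow> real^2) \<Rightarrow> real^2 \<Rightarrow> real^2" where
  "finite_diff U z f x = (if x \<in> U \<and> x + z \<in> U then f (x + z) - f x else 0)"

(* B^s_{4,infinity}(U), meant for 0 < s < 1 and U open. *)
definition besov_4_inf :: "real \<Rightarrow> (real^2) set \<Rightarrow> (real^2 \<Rightarrow> real^2) set" where
  "besov_4_inf s U = {f. f \<in> borel_measurable (lebesgue_on U) \<and>
     L4_norm U f + (SUP t\<in>{0<..1}. ennreal (t powr - s) *
                      (SUP z\<in>{z. norm z \<le> t}. L4_norm U (finite_diff U z f))) < \<infinity>}"

definition besov_4_inf_loc :: "real \<Rightarrow> (real^2) set \<Rightarrow> (real^2 \<Rightarrow> real^2) set" where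
  "besov_4_inf_loc s \<Omega> =
     (\<Inter>U\<in>{U. open U \<and> compact (closure U) \<and> closure U \<subseteq> \<Omega>}. besov_4_inf s U)"

end

theory Submission
  imports Defs
begin

text \<open>Let $F$ and $G$ be the two fields $\Sigma(m)$ of the hypotheses, and let $D$ denote the finite
difference with step $z = h e$, where $e$ is a unit vector and $n$ is $e$ rotated by a right angle.
Write $a \wedge b = a_1 b_2 - a_2 b_1$.

On the unit circle the chords of the pair of fields satisfy
$DF \wedge DG \ge \frac29 |Dm|^4$ (\<open>wedge_coercive\<close>). It therefore suffices to show
$\int \eta^2\, DF \wedge DG \le C h$ for a cutoff $\eta$ supported in a small ball. This gives
$\int_U |D m|^4 \le C h$ on every $U$ compactly contained in $\Omega$, hence
$h^{-1/4} \|D m\|_{L^4(U)}$ is bounded, and so is $h^{-s} \|D m\|_{L^4(U)}$ for $s < \frac14$.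

The linear bound comes from an interaction identity. Put $A = \eta\, DF$ and $B = \eta\, DG$. Their
divergences $\Lambda_A$ and $\Lambda_B$ are finite measures with masses bounded independently of $z$
(\<open>localized_difference_charge\<close>). Integrating by parts in the direction $e$ gives
$$\int A \wedge B = \Lambda_A(\beta) + \Lambda_B(\alpha), \qquad
  \beta(x) = \int_0^\infty (B \cdot n)(x + s e)\, ds, \quad
  \alpha(y) = \int_0^\infty (A \cdot n)(y - s e)\, ds.$$
The antiderivatives are taken in the direction in which the differences were formed. Up to the
variation of $\eta$ they telescope to integrals over segments of length $h$, so
$|\alpha|, |\beta| \le C h$ (\<open>oscillation_along_direction\<close>).

Since $A$ and $B$ are merely bounded and measurable, the identity is proved in a regularised form
(\<open>wedge_kernel_identity\<close>). A smooth kernel $k(x - y)$ approximates the measure on the half line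
spanned by $-e$; the divergence of $A$ is tested with $x \mapsto k(x - y)$ and that of $B$ with
$y \mapsto k(x - y)$. The derivatives of $k$ across $e$ cancel, and the derivative along $e$ is
minus an approximate identity, so the left-hand side is recovered in the limit
(\<open>wedge_integral_bound\<close>).\<close>

section \<open>Smooth functions on the plane\<close>

abbreviation smooth :: "(real^2 \<Rightarrow> real) \<Rightarrow> bool" where
  "smooth f \<equiv> \<forall>k. Ck k f"

lemma Ck_SucD: "Ck (Suc k) f \<Longrightarrow> Ck k f"
proof (induction k arbitrary: f)
  case 0
  then show ?case
    by (simp add: continuous_on_eq_continuous_within differentiable_imp_continuous_within)
next
  case (Suc k)
  then show ?case by (metis Ck.simps(2))
qed

lemma partial_deriv_eq:
  assumes "(f has_derivative f') (at x)"
  shows "partial_deriv i f x = f' (axis i 1)"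
  unfolding partial_deriv_def using frechet_derivative_at[OF assms] by simp

lemma has_derivative_frechet:
  "f differentiable (at x) \<Longrightarrow> (f has_derivative frechet_derivative f (at x)) (at x)"
  by (simp add: frechet_derivative_works[symmetric])

lemma grad_eqI:
  assumes "(f has_derivative (\<lambda>h. v \<bullet> h)) (at x)"
  shows "grad f x = v"
  by (simp add: vec_eq_iff grad_def partial_deriv_eq[OF assms] inner_axis)

lemma has_derivative_grad:
  assumes "f differentiable (at x)"
  shows "(f has_derivative (\<lambda>h. grad f x \<bullet> h)) (at x)"
proof -
  let ?D = "frechet_derivative f (at x)"
  have D: "(f has_derivative ?D) (at x)" by (rule has_derivative_frechet[OF assms])
  then have lin: "linear ?D" by (rule has_derivative_linear)
  have "?D h = grad f x \<bullet> h" for h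
  proof -
    have "h = (\<Sum>i\<in>UNIV. h $ i *\<^sub>R axis i 1)"
      using basis_expansion[of h] by (simp add: scalar_mult_eq_scaleR)
    then have "?D h = ?D (\<Sum>i\<in>UNIV. h $ i *\<^sub>R axis i 1)" by simp
    also have "\<dots> = (\<Sum>i\<in>UNIV. h $ i * ?D (axis i 1))"
      by (simp add: linear_sum[OF lin] linear_scale[OF lin])
    also have "\<dots> = grad f x \<bullet> h"
      by (simp add: inner_vec_def grad_def partial_deriv_def mult.commute)
    finally show ?thesis .
  qed
  then have "?D = (\<lambda>h. grad f x \<bullet> h)" by auto
  with D show ?thesis by simp
qed

lemma smooth_differentiable: "smooth f \<Longrightarrow> f differentiable (at x)"
  by (metis Ck.simps(2))

lemma smooth_continuous: "smooth f \<Longrightarrow> continuous_on UNIV f"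
  by (metis Ck.simps(1))

lemma smooth_partial_deriv: "smooth f \<Longrightarrow> smooth (partial_deriv i f)"
  by (metis Ck.simps(2))

lemma smooth_grad_continuous:
  assumes "smooth f" shows "continuous_on UNIV (grad f)"
  unfolding grad_def[abs_def]
  using smooth_continuous[OF smooth_partial_deriv[OF assms]] by (intro continuous_intros) auto

lemma partial_deriv_add:
  "f differentiable (at x) \<Longrightarrow> g differentiable (at x) \<Longrightarrow>
   partial_deriv i (\<lambda>x. f x + g x) x = partial_deriv i f x + partial_deriv i g x"
  by (rule partial_deriv_eq[OF has_derivative_add[OF has_derivative_frechet has_derivative_frechet],
        THEN trans]) (auto simp: partial_deriv_def)

lemma partial_deriv_mult:
  "f differentiable (at x) \<Longrightarrow> g differentiable (at x) \<Longrightarrow>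
   partial_deriv i (\<lambda>x. f x * g x) x = f x * partial_deriv i g x + partial_deriv i f x * g x"
  by (rule partial_deriv_eq[OF has_derivative_mult[OF has_derivative_frechet has_derivative_frechet],
        THEN trans]) (auto simp: partial_deriv_def)

lemma Ck_add: "Ck k f \<Longrightarrow> Ck k g \<Longrightarrow> Ck k (\<lambda>x. f x + g x)"
proof (induction k arbitrary: f g)
  case 0
  then show ?case by (auto intro: continuous_intros)
next
  case (Suc k)
  then have "partial_deriv i (\<lambda>x. f x + g x) = (\<lambda>x. partial_deriv i f x + partial_deriv i g x)" for i
    using partial_deriv_add[of f _ g] by auto
  with Suc show ?case by (auto intro: differentiable_add)
qed

lemma Ck_mult: "Ck k f \<Longrightarrow> Ck k g \<Longrightarrow> Ck k (\<lambda>x. f x * g x)"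
proof (induction k arbitrary: f g)
  case 0
  then show ?case by (auto intro: continuous_intros)
next
  case (Suc k)
  then have "partial_deriv i (\<lambda>x. f x * g x) =
      (\<lambda>x. f x * partial_deriv i g x + partial_deriv i f x * g x)" for i
    using partial_deriv_mult[of f _ g] by auto
  moreover have "Ck k f" "Ck k g" using Suc.prems Ck_SucD by auto
  ultimately show ?case using Suc by (auto intro!: differentiable_mult Ck_add)
qed

lemma Ck_const: "Ck k (\<lambda>x. c)"
proof (induction k arbitrary: c)
  case (Suc k)
  have "partial_deriv i (\<lambda>x. c) = (\<lambda>x. 0)" for i
    using partial_deriv_eq[OF has_derivative_const[of c]] by auto
  with Suc show ?case by simp
qed simp

lemma Ck_inner: "Ck k (\<lambda>x. x \<bullet> v)"
proof (cases k)
  case (Suc l)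
  have D: "((\<lambda>x. x \<bullet> v) has_derivative (\<lambda>h. h \<bullet> v)) (at x)" for x :: "real^2"
    by (auto intro!: derivative_eq_intros)
  have "partial_deriv i (\<lambda>x. x \<bullet> v) = (\<lambda>x. axis i 1 \<bullet> v)" for i
    using partial_deriv_eq[OF D] by auto
  with Suc show ?thesis using D by (auto simp: Ck_const intro: differentiableI)
qed (auto intro: continuous_intros)

lemma Ck_translate: "Ck k f \<Longrightarrow> Ck k (\<lambda>x. f (x + v))"
proof (induction k arbitrary: f)
  case 0
  then show ?case by (auto intro!: continuous_on_compose2[of UNIV f] continuous_intros)
next
  case (Suc k)
  have D: "((\<lambda>x. f (x + v)) has_derivative frechet_derivative f (at (x + v))) (at x)" for x
  proof -
    have "(f has_derivative frechet_derivative f (at (x + v))) (at (x + v))"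
      using Suc.prems by (auto intro: has_derivative_frechet)
    moreover have "((\<lambda>x. x + v) has_derivative (\<lambda>h. h)) (at x)"
      by (auto intro!: derivative_eq_intros)
    ultimately show ?thesis using has_derivative_compose[of "\<lambda>x. x + v" "\<lambda>h. h" x UNIV f] by simp
  qed
  have "partial_deriv i (\<lambda>x. f (x + v)) = (\<lambda>x. partial_deriv i f (x + v))" for i
    using partial_deriv_eq[OF D] by (auto simp: partial_deriv_def)
  moreover have "Ck k (\<lambda>x. partial_deriv i f (x + v))" for i
    using Suc.prems by (intro Suc.IH) simp
  moreover have "(\<lambda>x. f (x + v)) differentiable (at x)" for x
    using D by (rule differentiableI)
  ultimately show ?case by simp
qed

text \<open>The sequence of all derivatives is part of the definition because the chain rule for \<open>Ck\<close> consumes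
it one term at a time.\<close>
definition smooth_real :: "(real \<Rightarrow> real) \<Rightarrow> bool" where
  "smooth_real f \<longleftrightarrow> (\<exists>F. F 0 = f \<and> (\<forall>n t. (F n has_real_derivative F (Suc n) t) (at t)))"

text \<open>The induction on $k$ replaces the outer function by its derivative, so all derivatives $F_n$ are
treated at once.\<close>
lemma Ck_compose:
  assumes F: "\<And>n t. (F n has_real_derivative F (Suc n) t) (at t)"
    and "Ck k g"
  shows "Ck k (\<lambda>x. F n (g x))"
  using assms(2)
proof (induction k arbitrary: n)
  case 0
  have "continuous_on UNIV (F n)"
    by (meson F DERIV_isCont continuous_at_imp_continuous_on)
  with 0 show ?case using continuous_on_compose2[of UNIV "F n" UNIV g] by simp
next
  case (Suc k)
  have D: "((\<lambda>x. F n (g x)) has_derivative (\<lambda>h. F (Suc n) (g x) * frechet_derivative g (at x) h)) (at x)" for x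
  proof -
    have "(g has_derivative frechet_derivative g (at x)) (at x)"
      using Suc.prems by (auto intro: has_derivative_frechet)
    then show ?thesis
      using has_derivative_compose[OF _ F[unfolded has_field_derivative_def], of g _ x UNIV n] by simp
  qed
  have "partial_deriv i (\<lambda>x. F n (g x)) = (\<lambda>x. F (Suc n) (g x) * partial_deriv i g x)" for i
    using partial_deriv_eq[OF D] by (auto simp: partial_deriv_def)
  moreover have "Ck k (\<lambda>x. F (Suc n) (g x) * partial_deriv i g x)" for i
    using Ck_mult[OF Suc.IH[OF Ck_SucD[OF Suc.prems], of "Suc n"]] Suc.prems by simp
  moreover have "(\<lambda>x. F n (g x)) differentiable (at x)" for x
    using D by (rule differentiableI)
  ultimately show ?case by simp
qed

lemma smooth_compose: "smooth_real f \<Longrightarrow> smooth g \<Longrightarrow> smooth (\<lambda>x. f (g x))"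
  unfolding smooth_real_def using Ck_compose[of _ _ g 0] by auto

section \<open>A cutoff profile and a step profile\<close>

definition flat_exp :: "real \<Rightarrow> real" where
  "flat_exp t = (if t > 0 then exp (- (1 / t)) else 0)"

text \<open>The derivatives of \<open>flat_exp\<close> on the positive half line are polynomials in $1/t$ times
$e^{-1/t}$; this limit makes them vanish at the origin together with their difference quotients.\<close>
lemma poly_exp_decay: "((\<lambda>t. poly p (1 / t) * exp (- (1 / t))) \<longlongrightarrow> 0) (at_right (0::real))"
proof -
  have "((\<lambda>u. poly p u * exp (- u)) \<longlongrightarrow> 0) at_top"
  proof -
    have "((\<lambda>u. \<Sum>i\<le>degree p. coeff p i * (u ^ i / exp u)) \<longlongrightarrow> (\<Sum>i\<le>degree p. coeff p i * 0)) at_top"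
      by (intro tendsto_sum tendsto_mult tendsto_const tendsto_power_div_exp_0)
    moreover have "(\<lambda>u. \<Sum>i\<le>degree p. coeff p i * (u ^ i / exp u)) = (\<lambda>u. poly p u * exp (- u))"
      by (simp add: poly_altdef sum_distrib_right exp_minus divide_inverse mult.assoc)
    ultimately show ?thesis by simp
  qed
  moreover have "filterlim (\<lambda>t::real. 1 / t) at_top (at_right 0)"
    using filterlim_inverse_at_top_right by (simp add: inverse_eq_divide)
  ultimately show ?thesis by (rule filterlim_compose)
qed

text \<open>The $n$-th derivative of \<open>flat_exp\<close> at $t > 0$ is \<open>flat_poly n\<close>, evaluated at $1/t$, times
$e^{-1/t}$.\<close>
fun flat_poly :: "nat \<Rightarrow> real poly" where
  "flat_poly 0 = 1"
| "flat_poly (Suc n) = [:0, 0, 1:] * (flat_poly n - pderiv (flat_poly n))"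

lemma flat_exp_smooth: "smooth_real flat_exp"
  unfolding smooth_real_def
proof (intro exI conjI allI)
  let ?F = "\<lambda>n t. if t > 0 then poly (flat_poly n) (1 / t) * exp (- (1 / t)) else (0::real)"
  show "?F 0 = flat_exp" by (auto simp: flat_exp_def)
  fix n and t :: real
  consider "t > 0" | "t < 0" | "t = 0" by linarith
  then show "(?F n has_real_derivative ?F (Suc n) t) (at t)"
  proof cases
    case 1
    have "((\<lambda>t. poly (flat_poly n) (1 / t) * exp (- (1 / t))) has_real_derivative ?F (Suc n) t) (at t)"
      using 1 by (auto intro!: derivative_eq_intros DERIV_chain'[OF _ poly_DERIV]
          simp: field_simps power2_eq_square)
    moreover have "\<forall>\<^sub>F s in nhds t. poly (flat_poly n) (1 / s) * exp (- (1 / s)) = ?F n s"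
      using eventually_nhds_in_open[of "{0<..}" t] 1 by (auto elim!: eventually_mono)
    ultimately show ?thesis by (subst (asm) DERIV_cong_ev[OF refl _ refl])
  next
    case 2
    have "((\<lambda>t. 0) has_real_derivative ?F (Suc n) t) (at t)" using 2 by auto
    moreover have "\<forall>\<^sub>F s in nhds t. 0 = ?F n s"
      using eventually_nhds_in_open[of "{..<0}" t] 2 by (auto elim!: eventually_mono)
    ultimately show ?thesis by (subst (asm) DERIV_cong_ev[OF refl _ refl])
  next
    case 3
    have "((\<lambda>h. (?F n h - ?F n 0) / h) \<longlongrightarrow> 0) (at_right 0)"
    proof (rule Lim_transform_eventually[OF poly_exp_decay[of "[:0, 1:] * flat_poly n"]])
      show "\<forall>\<^sub>F h in at_right 0. poly ([:0, 1:] * flat_poly n) (1 / h) * exp (- (1 / h)) =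
          (?F n h - ?F n 0) / h"
        using eventually_at_right_less[of 0] by eventually_elim auto
    qed
    moreover have "((\<lambda>h. (?F n h - ?F n 0) / h) \<longlongrightarrow> 0) (at_left 0)"
    proof (rule Lim_transform_eventually[OF tendsto_const])
      show "\<forall>\<^sub>F h in at_left 0. 0 = (?F n h - ?F n 0) / h"
        by (simp add: eventually_at_filter)
    qed
    ultimately have "((\<lambda>h. (?F n h - ?F n 0) / h) \<longlongrightarrow> 0) (at 0)"
      by (rule filterlim_split_at[rotated])
    then show ?thesis by (simp only: 3 DERIV_def add_0_left less_irrefl if_False)
  qed
qed

text \<open>A decreasing step from $1$ to $0$. Its advantage over other smooth steps is the differential
equation $\ell' = -\ell (1 - \ell)$: every derivative is a polynomial in $\ell$, so smoothness and
boundedness of all derivatives are immediate.\<close>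
definition logistic :: "real \<Rightarrow> real" where
  "logistic t = 1 / (1 + exp t)"

lemma logistic_deriv:
  "(logistic has_real_derivative - (logistic t * (1 - logistic t))) (at t)"
proof -
  have "1 + exp t \<noteq> 0" by (metis add_pos_pos exp_gt_zero less_irrefl zero_less_one)
  then show ?thesis unfolding logistic_def
    by (auto intro!: derivative_eq_intros simp: field_simps power2_eq_square)
qed

lemma smooth_real_poly_logistic: "smooth_real (\<lambda>t. poly p (logistic (c * t)))"
  unfolding smooth_real_def
proof (intro exI conjI allI)
  define P where "P = rec_nat p (\<lambda>_ q. smult c (pderiv q * [:0, -1, 1:]))"
  let ?F = "\<lambda>n t. poly (P n) (logistic (c * t))"
  show "?F 0 = (\<lambda>t. poly p (logistic (c * t)))" by (simp add: P_def)
  fix n and t :: real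
  have "((\<lambda>t. logistic (c * t)) has_real_derivative - (logistic (c * t) * (1 - logistic (c * t))) * c) (at t)"
    by (rule DERIV_chain'[OF _ logistic_deriv]) (auto intro!: derivative_eq_intros)
  from DERIV_chain'[OF this poly_DERIV[of "P n"]]
  show "(?F n has_real_derivative ?F (Suc n) t) (at t)"
    by (simp add: P_def algebra_simps)
qed

section \<open>Lebesgue measure in a rotated frame\<close>

definition rot :: "real^2 \<Rightarrow> real^2" where
  "rot e = vector [- (e $ 2), e $ 1]"

lemma inner_vec2: "(x::real^2) \<bullet> y = x $ 1 * y $ 1 + x $ 2 * y $ 2"
  by (simp add: inner_vec_def sum_2)

lemma lborel_orthogonal_image:
  fixes Q :: "real^2 \<Rightarrow> real^2"
  assumes Q: "orthogonal_transformation Q"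
  shows "distr lborel borel Q = lborel"
proof (rule lborel_eqI[symmetric])
  fix l u :: "real^2"
  assume lu: "\<And>b. b \<in> Basis \<Longrightarrow> l \<bullet> b \<le> u \<bullet> b"
  have [measurable]: "Q \<in> borel_measurable borel"
    using orthogonal_transformation_linear[OF Q]
    by (intro borel_measurable_continuous_onI linear_continuous_on) (simp add: linear_conv_bounded_linear)
  have inv: "orthogonal_transformation (inv Q)" by (rule orthogonal_transformation_inv[OF Q])
  have eq: "Q -` box l u = inv Q ` box l u"
    using bij_vimage_eq_inv_image[OF orthogonal_transformation_bij[OF Q]] .
  have "emeasure (distr lborel borel Q) (box l u) = emeasure lborel (Q -` box l u)"
    by (simp add: emeasure_distr)
  also have "\<dots> = emeasure lebesgue (inv Q ` box l u)"
    using measurable_sets_borel[of Q borel "box l u"] by (simp add: eq[symmetric] emeasure_completion)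
  also have "\<dots> = ennreal (measure lebesgue (inv Q ` box l u))"
    using measurable_orthogonal_image[OF inv lmeasurable_box]
    by (simp add: emeasure_eq_measure2 del: measure_lborel_box)
  also have "measure lebesgue (inv Q ` box l u) = measure lebesgue (box l u)"
    by (rule measure_orthogonal_image[OF inv lmeasurable_box])
  also have "ennreal (measure lebesgue (box l u)) = (\<Prod>b\<in>Basis. (u - l) \<bullet> b)"
    using lu by (simp add: measure_lborel_box_eq inner_diff_left)
  finally show "emeasure (distr lborel borel Q) (box l u) = (\<Prod>b\<in>Basis. (u - l) \<bullet> b)" .
qed simp

lemma orthogonal_frame:
  assumes "norm e = 1"
  shows "orthogonal_transformation (\<lambda>x. vector [x \<bullet> e, x \<bullet> rot e] :: real^2)"
  unfolding orthogonal_transformation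
proof (intro conjI allI)
  show "linear (\<lambda>x. vector [x \<bullet> e, x \<bullet> rot e] :: real^2)"
    by (intro linearI) (simp_all add: vec_eq_iff forall_2 inner_add_left)
  fix x
  have e: "e $ 1 * e $ 1 + e $ 2 * e $ 2 = 1"
    using assms by (simp add: norm_eq_sqrt_inner inner_vec2)
  have "(x \<bullet> e) * (x \<bullet> e) + (x \<bullet> rot e) * (x \<bullet> rot e)
      = (x $ 1 * x $ 1 + x $ 2 * x $ 2) * (e $ 1 * e $ 1 + e $ 2 * e $ 2)"
    by (simp add: inner_vec2 rot_def algebra_simps)
  then show "norm (vector [x \<bullet> e, x \<bullet> rot e] :: real^2) = norm x"
    by (simp add: norm_eq_sqrt_inner inner_vec2[of _ _] e)
qed

lemma Basis_2: "(Basis :: (real^2) set) = {axis 1 1, axis 2 1}"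
  by (auto simp: Basis_vec_def UNIV_2)

text \<open>The map $x \mapsto (x \cdot e, x \cdot n)$ is orthogonal and preserves Lebesgue measure, which turns
the integral into one over a product.\<close>
lemma nn_integral_frame:
  assumes e: "norm e = 1" and [measurable]: "p \<in> borel_measurable borel" "q \<in> borel_measurable borel"
  shows "(\<integral>\<^sup>+x. p (x \<bullet> e) * q (x \<bullet> rot e) \<partial>lborel) = (\<integral>\<^sup>+t. p t \<partial>lborel) * (\<integral>\<^sup>+t. q t \<partial>lborel)"
proof -
  let ?Q = "\<lambda>x. vector [x \<bullet> e, x \<bullet> rot e] :: real^2"
  have [measurable]: "?Q \<in> borel_measurable borel"
    using orthogonal_transformation_linear[OF orthogonal_frame[OF e]]
    by (intro borel_measurable_continuous_onI linear_continuous_on) (simp add: linear_conv_bounded_linear)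
  have ne: "axis 1 (1::real) \<noteq> (axis 2 1 :: real^2)" by (simp add: axis_eq_axis)
  let ?f = "\<lambda>b::real^2. if b = axis 1 1 then p else q"
  have "(\<integral>\<^sup>+x. p (x \<bullet> e) * q (x \<bullet> rot e) \<partial>lborel)
      = (\<integral>\<^sup>+x. p (?Q x $ 1) * q (?Q x $ 2) \<partial>lborel)"
    by simp
  also have "\<dots> = (\<integral>\<^sup>+x. p (x $ 1) * q (x $ 2) \<partial>distr lborel borel ?Q)"
    by (rule nn_integral_distr[symmetric]) measurable
  also have "\<dots> = (\<integral>\<^sup>+x. (\<Prod>b\<in>Basis. ?f b (x \<bullet> b)) \<partial>(lborel :: (real^2) measure))"
    using ne by (simp add: lborel_orthogonal_image[OF orthogonal_frame[OF e]] Basis_2 inner_axis)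
  also have "\<dots> = (\<Prod>b\<in>Basis. (\<integral>\<^sup>+t. ?f b t \<partial>lborel))"
    by (rule nn_integral_lborel_prod) auto
  also have "\<dots> = (\<integral>\<^sup>+t. p t \<partial>lborel) * (\<integral>\<^sup>+t. q t \<partial>lborel)"
    using ne by (simp add: Basis_2)
  finally show ?thesis .
qed

section \<open>Finite signed measures as functionals\<close>

text \<open>A finite signed Borel measure of mass at most $C$, described by the two properties that the argument
uses: the bound by $C \sup |\phi|$ and the exchange with Lebesgue integrals. The divergence of a
localised difference is a sum of translated, weighted and absolutely continuous measures; in this
form the sum needs no Jordan decomposition.\<close>
definition charge :: "((real^2 \<Rightarrow> real) \<Rightarrow> real) \<Rightarrow> real \<Rightarrow> bool" where
  "charge \<Lambda> C \<longleftrightarrow> 0 \<le> C \<and>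
     (\<forall>\<phi> c. \<phi> \<in> borel_measurable borel \<longrightarrow> (\<forall>x. \<bar>\<phi> x\<bar> \<le> c) \<longrightarrow> \<bar>\<Lambda> \<phi>\<bar> \<le> C * c) \<and>
     (\<forall>w \<Phi> c. integrable lborel w \<longrightarrow> case_prod \<Phi> \<in> borel_measurable (borel \<Otimes>\<^sub>M borel) \<longrightarrow>
        (\<forall>x y. \<bar>\<Phi> x y\<bar> \<le> c) \<longrightarrow>
        integrable lborel (\<lambda>y::real^2. w y * \<Lambda> (\<lambda>x. \<Phi> x y)) \<and>
        (LINT y|lborel. w y * \<Lambda> (\<lambda>x. \<Phi> x y)) = \<Lambda> (\<lambda>x. LINT y|lborel. w y * \<Phi> x y))"

lemma charge_bound:
  "charge \<Lambda> C \<Longrightarrow> \<phi> \<in> borel_measurable borel \<Longrightarrow> (\<And>x. \<bar>\<phi> x\<bar> \<le> c) \<Longrightarrow> \<bar>\<Lambda> \<phi>\<bar> \<le> C * c"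
  unfolding charge_def by blast

lemma charge_Fubini:
  assumes "charge \<Lambda> C" "integrable lborel w" "case_prod \<Phi> \<in> borel_measurable (borel \<Otimes>\<^sub>M borel)"
    "\<And>x y. \<bar>\<Phi> x y\<bar> \<le> c"
  shows "integrable lborel (\<lambda>y::real^2. w y * \<Lambda> (\<lambda>x. \<Phi> x y))"
    and "(LINT y|lborel. w y * \<Lambda> (\<lambda>x. \<Phi> x y)) = \<Lambda> (\<lambda>x. LINT y|lborel. w y * \<Phi> x y)"
  using assms unfolding charge_def by blast+

lemma integral_mult_bound:
  fixes f w :: "real^2 \<Rightarrow> real"
  assumes "integrable lborel w" "f \<in> borel_measurable borel" "\<And>y. \<bar>f y\<bar> \<le> c"
  shows "integrable lborel (\<lambda>y. w y * f y)" "\<bar>LINT y|lborel. w y * f y\<bar> \<le> (LINT y|lborel. \<bar>w y\<bar>) * c"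
proof -
  have c: "0 \<le> c" using assms(3)[of 0] by linarith
  note [measurable] = borel_measurable_integrable[OF assms(1)] assms(2)
  have le: "\<bar>w y * f y\<bar> \<le> \<bar>w y\<bar> * c" for y
    by (simp add: abs_mult mult_left_mono assms(3))
  have wi: "integrable lborel (\<lambda>y. \<bar>w y\<bar> * c)" using assms(1) by auto
  show i: "integrable lborel (\<lambda>y. w y * f y)"
    by (rule Bochner_Integration.integrable_bound[OF wi]) (use le c in \<open>auto simp: abs_mult\<close>)
  have "\<bar>LINT y|lborel. w y * f y\<bar> \<le> (LINT y|lborel. \<bar>w y * f y\<bar>)"
    using integral_norm_bound[of lborel "\<lambda>y. w y * f y"] by simp
  also have "\<dots> \<le> (LINT y|lborel. \<bar>w y\<bar> * c)"
    using i wi le by (intro integral_mono) auto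
  finally show "\<bar>LINT y|lborel. w y * f y\<bar> \<le> (LINT y|lborel. \<bar>w y\<bar>) * c" by simp
qed

lemma charge_finite_measure:
  assumes fin: "finite_measure N" and s: "sets N = sets borel"
  shows "charge (\<lambda>\<phi>. LINT x|N. \<phi> x) (measure N (space N))"
proof -
  interpret N: finite_measure N by fact
  interpret P: pair_sigma_finite N "lborel :: (real^2) measure" ..
  note [measurable_cong] = s
  show ?thesis unfolding charge_def
  proof (intro conjI allI impI)
    fix \<phi> :: "real^2 \<Rightarrow> real" and c
    assume [measurable]: "\<phi> \<in> borel_measurable borel" and b: "\<forall>x. \<bar>\<phi> x\<bar> \<le> c"
    have i: "integrable N \<phi>" by (rule N.integrable_const_bound[of _ c]) (use b in auto)
    have "\<bar>LINT x|N. \<phi> x\<bar> \<le> (LINT x|N. \<bar>\<phi> x\<bar>)"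
      using integral_norm_bound[of N \<phi>] by simp
    also have "\<dots> \<le> (LINT x|N. c)"
      using i b by (intro integral_mono) auto
    finally show "\<bar>LINT x|N. \<phi> x\<bar> \<le> measure N (space N) * c" by simp
  next
    fix w :: "real^2 \<Rightarrow> real" and \<Phi> :: "real^2 \<Rightarrow> real^2 \<Rightarrow> real" and c
    assume w: "integrable lborel w" and P[measurable]: "case_prod \<Phi> \<in> borel_measurable (borel \<Otimes>\<^sub>M borel)"
      and b: "\<forall>x y. \<bar>\<Phi> x y\<bar> \<le> c"
    have c: "0 \<le> c" using b[rule_format, of 0 0] by linarith
    have [measurable]: "w \<in> borel_measurable borel" using borel_measurable_integrable[OF w] by simp
    have "integrable (N \<Otimes>\<^sub>M lborel) (\<lambda>z. c * w (snd z))"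
    proof (rule P.Fubini_integrable)
      show "integrable N (\<lambda>x. LINT y|lborel. norm (c * w (snd (x, y))))" by simp
      show "AE x in N. integrable lborel (\<lambda>y. c * w (snd (x, y)))" using w by simp
    qed measurable
    then have I: "integrable (N \<Otimes>\<^sub>M lborel) (\<lambda>(x, y). w y * \<Phi> x y)"
    proof (rule Bochner_Integration.integrable_bound)
      show "AE z in N \<Otimes>\<^sub>M lborel. norm (case z of (x, y) \<Rightarrow> w y * \<Phi> x y) \<le> norm (c * w (snd z))"
        using b c by (intro AE_I2) (auto simp: abs_mult mult.commute[of c] intro!: mult_left_mono)
    qed measurable
    have eq: "(\<lambda>y. w y * (LINT x|N. \<Phi> x y)) = (\<lambda>y. LINT x|N. w y * \<Phi> x y)" by simp
    show "integrable lborel (\<lambda>y. w y * (LINT x|N. \<Phi> x y))"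
      unfolding eq by (rule P.integrable_snd[OF I])
    show "(LINT y|lborel. w y * (LINT x|N. \<Phi> x y)) = (LINT x|N. LINT y|lborel. w y * \<Phi> x y)"
      unfolding eq by (rule P.Fubini_integral[OF I])
  qed simp
qed

lemma charge_diff:
  assumes "charge \<Lambda> C" "charge \<Lambda>' C'"
  shows "charge (\<lambda>\<phi>. \<Lambda> \<phi> - \<Lambda>' \<phi>) (C + C')"
  unfolding charge_def
proof (intro conjI allI impI)
  show "0 \<le> C + C'" using assms by (simp add: charge_def)
next
  fix \<phi> :: "real^2 \<Rightarrow> real" and c
  assume "\<phi> \<in> borel_measurable borel" "\<forall>x. \<bar>\<phi> x\<bar> \<le> c"
  then show "\<bar>\<Lambda> \<phi> - \<Lambda>' \<phi>\<bar> \<le> (C + C') * c"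
    using charge_bound[OF assms(1), of \<phi> c] charge_bound[OF assms(2), of \<phi> c] by (simp add: distrib_right)
next
  fix w :: "real^2 \<Rightarrow> real" and \<Phi> :: "real^2 \<Rightarrow> real^2 \<Rightarrow> real" and c
  assume h: "integrable lborel w" "case_prod \<Phi> \<in> borel_measurable (borel \<Otimes>\<^sub>M borel)"
      "\<forall>x y. \<bar>\<Phi> x y\<bar> \<le> c"
  note 1 = charge_Fubini[OF assms(1) h(1,2) h(3)[rule_format]]
   and 2 = charge_Fubini[OF assms(2) h(1,2) h(3)[rule_format]]
  show "integrable lborel (\<lambda>y. w y * (\<Lambda> (\<lambda>x. \<Phi> x y) - \<Lambda>' (\<lambda>x. \<Phi> x y)))"
    using 1(1) 2(1) by (simp add: right_diff_distrib)
  show "(LINT y|lborel. w y * (\<Lambda> (\<lambda>x. \<Phi> x y) - \<Lambda>' (\<lambda>x. \<Phi> x y))) =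
       \<Lambda> (\<lambda>x. LINT y|lborel. w y * \<Phi> x y) - \<Lambda>' (\<lambda>x. LINT y|lborel. w y * \<Phi> x y)"
    using 1 2 by (simp add: right_diff_distrib)
qed

lemma charge_weight:
  assumes \<Lambda>: "charge \<Lambda> C" and [measurable]: "g \<in> borel_measurable borel" and g: "\<And>x. \<bar>g x\<bar> \<le> K"
  shows "charge (\<lambda>\<phi>. \<Lambda> (\<lambda>x. g x * \<phi> x)) (C * K)"
  unfolding charge_def
proof (intro conjI allI impI)
  have K: "0 \<le> K" using g[of 0] by linarith
  then show "0 \<le> C * K" using \<Lambda> by (simp add: charge_def)
  fix \<phi> :: "real^2 \<Rightarrow> real" and c
  assume [measurable]: "\<phi> \<in> borel_measurable borel" and b: "\<forall>x. \<bar>\<phi> x\<bar> \<le> c"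
  have "\<bar>g x * \<phi> x\<bar> \<le> K * c" for x
    unfolding abs_mult using g b K by (intro mult_mono) auto
  then show "\<bar>\<Lambda> (\<lambda>x. g x * \<phi> x)\<bar> \<le> C * K * c"
    using charge_bound[OF \<Lambda>, of "\<lambda>x. g x * \<phi> x" "K * c"] by (simp add: mult.assoc)
next
  have K: "0 \<le> K" using g[of 0] by linarith
  fix w :: "real^2 \<Rightarrow> real" and \<Phi> :: "real^2 \<Rightarrow> real^2 \<Rightarrow> real" and c
  assume h: "integrable lborel w" and m[measurable]: "case_prod \<Phi> \<in> borel_measurable (borel \<Otimes>\<^sub>M borel)"
      and b: "\<forall>x y. \<bar>\<Phi> x y\<bar> \<le> c"
  have b': "\<bar>g x * \<Phi> x y\<bar> \<le> K * c" for x y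
    unfolding abs_mult using g b K by (intro mult_mono) auto
  have m': "case_prod (\<lambda>x y. g x * \<Phi> x y) \<in> borel_measurable (borel \<Otimes>\<^sub>M borel)" by measurable
  note 1 = charge_Fubini[OF \<Lambda> h m' b']
  show "integrable lborel (\<lambda>y. w y * \<Lambda> (\<lambda>x. g x * \<Phi> x y))" by (rule 1)
  show "(LINT y|lborel. w y * \<Lambda> (\<lambda>x. g x * \<Phi> x y)) = \<Lambda> (\<lambda>x. g x * (LINT y|lborel. w y * \<Phi> x y))"
    using 1(2) by (simp add: mult.left_commute)
qed

lemma charge_translate:
  assumes \<Lambda>: "charge \<Lambda> C"
  shows "charge (\<lambda>\<phi>. \<Lambda> (\<lambda>x. \<phi> (x + v))) C"
  unfolding charge_def
proof (intro conjI allI impI)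
  show "0 \<le> C" using \<Lambda> by (simp add: charge_def)
  fix \<phi> :: "real^2 \<Rightarrow> real" and c
  assume [measurable]: "\<phi> \<in> borel_measurable borel" and b: "\<forall>x. \<bar>\<phi> x\<bar> \<le> c"
  then show "\<bar>\<Lambda> (\<lambda>x. \<phi> (x + v))\<bar> \<le> C * c"
    by (intro charge_bound[OF \<Lambda>]) auto
next
  fix w :: "real^2 \<Rightarrow> real" and \<Phi> :: "real^2 \<Rightarrow> real^2 \<Rightarrow> real" and c
  assume h: "integrable lborel w" and m[measurable]: "case_prod \<Phi> \<in> borel_measurable (borel \<Otimes>\<^sub>M borel)"
      and b: "\<forall>x y. \<bar>\<Phi> x y\<bar> \<le> c"
  have m': "case_prod (\<lambda>x y. \<Phi> (x + v) y) \<in> borel_measurable (borel \<Otimes>\<^sub>M borel)" by measurable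
  note 1 = charge_Fubini[OF \<Lambda> h m', of c]
  show "integrable lborel (\<lambda>y. w y * \<Lambda> (\<lambda>x. \<Phi> (x + v) y))" by (rule 1) (use b in auto)
  show "(LINT y|lborel. w y * \<Lambda> (\<lambda>x. \<Phi> (x + v) y)) = \<Lambda> (\<lambda>x. LINT y|lborel. w y * \<Phi> (x + v) y)"
    by (rule 1) (use b in auto)
qed

lemma charge_density:
  assumes f: "integrable lborel f"
  shows "charge (\<lambda>\<phi>. LINT x|lborel. f x * \<phi> x) (LINT x|lborel. \<bar>f x\<bar>)"
  unfolding charge_def
proof (intro conjI allI impI)
  have [measurable]: "f \<in> borel_measurable borel" using borel_measurable_integrable[OF f] by simp
  fix \<phi> :: "real^2 \<Rightarrow> real" and c
  assume "\<phi> \<in> borel_measurable borel" and b: "\<forall>x. \<bar>\<phi> x\<bar> \<le> c"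
  then show "\<bar>LINT x|lborel. f x * \<phi> x\<bar> \<le> (LINT x|lborel. \<bar>f x\<bar>) * c"
    by (intro integral_mult_bound[OF f]) auto
next
  have [measurable]: "f \<in> borel_measurable borel" using borel_measurable_integrable[OF f] by simp
  fix w :: "real^2 \<Rightarrow> real" and \<Phi> :: "real^2 \<Rightarrow> real^2 \<Rightarrow> real" and c
  assume w: "integrable lborel w" and P[measurable]: "case_prod \<Phi> \<in> borel_measurable (borel \<Otimes>\<^sub>M borel)"
      and b: "\<forall>x y. \<bar>\<Phi> x y\<bar> \<le> c"
  have c: "0 \<le> c" using b[rule_format, of 0 0] by linarith
  have [measurable]: "w \<in> borel_measurable borel" using borel_measurable_integrable[OF w] by simp
  have "integrable (lborel \<Otimes>\<^sub>M lborel) (\<lambda>z. c * f (fst z) * w (snd z))"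
    proof (rule lborel_pair.Fubini_integrable)
      show "integrable lborel (\<lambda>x. LINT y|lborel. norm (c * f (fst (x, y)) * w (snd (x, y))))"
        using f by (simp add: abs_mult)
      show "AE x in lborel. integrable lborel (\<lambda>y. c * f (fst (x, y)) * w (snd (x, y)))" using w by simp
    qed measurable
  then have I: "integrable (lborel \<Otimes>\<^sub>M lborel) (\<lambda>(x, y). w y * (f x * \<Phi> x y))"
  proof (rule Bochner_Integration.integrable_bound)
    have "\<bar>w y\<bar> * (\<bar>f x\<bar> * \<bar>\<Phi> x y\<bar>) \<le> \<bar>w y\<bar> * (\<bar>f x\<bar> * c)" for x y
      using b by (intro mult_left_mono) auto
    then show "AE z in lborel \<Otimes>\<^sub>M lborel. norm (case z of (x, y) \<Rightarrow> w y * (f x * \<Phi> x y)) \<le> norm (c * f (fst z) * w (snd z))"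
      using c by (intro AE_I2) (auto simp: abs_mult mult_ac)
  qed measurable
  have eq: "(\<lambda>y. w y * (LINT x|lborel. f x * \<Phi> x y)) = (\<lambda>y. LINT x|lborel. w y * (f x * \<Phi> x y))" by simp
  show "integrable lborel (\<lambda>y. w y * (LINT x|lborel. f x * \<Phi> x y))"
    unfolding eq by (rule lborel_pair.integrable_snd[OF I])
  have "(LINT y|lborel. w y * (LINT x|lborel. f x * \<Phi> x y)) = (LINT x|lborel. LINT y|lborel. w y * (f x * \<Phi> x y))"
    unfolding eq by (rule lborel_pair.Fubini_integral[OF I])
  then show "(LINT y|lborel. w y * (LINT x|lborel. f x * \<Phi> x y)) = (LINT x|lborel. f x * (LINT y|lborel. w y * \<Phi> x y))"
    by (simp add: mult.left_commute)
qed simp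

section \<open>Approximation of the identity\<close>

lemma integrable_bounded_support:
  fixes f :: "real^2 \<Rightarrow> real"
  assumes [measurable]: "f \<in> borel_measurable borel" and "\<And>x. \<bar>f x\<bar> \<le> K" "\<And>x. x \<notin> cball c R \<Longrightarrow> f x = 0"
  shows "integrable lborel f"
proof (rule Bochner_Integration.integrable_bound)
  show "integrable lborel (\<lambda>x. K * indicat_real (cball c R) x)"
    using emeasure_compact_finite[OF compact_cball[of c R]]
    by (intro integrable_mult_right integrable_real_indicator) (auto simp: less_top)
  show "AE x in lborel. norm (f x) \<le> norm (K * indicator (cball c R) x)"
  proof (intro AE_I2)
    fix x show "norm (f x) \<le> norm (K * indicator (cball c R) x)"
      using assms(2)[of x] assms(3)[of x] by (cases "x \<in> cball c R") auto
  qed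
qed simp

text \<open>A measurable function is an almost everywhere limit of continuous functions. Truncating those at
height $K$ and cutting them off outside a slightly larger ball makes dominated convergence
applicable.\<close>
lemma continuous_dense_L1:
  fixes v :: "real^2 \<Rightarrow> real"
  assumes [measurable]: "v \<in> borel_measurable borel" and K: "\<And>x. \<bar>v x\<bar> \<le> K"
    and supp: "\<And>x. x \<notin> cball c R \<Longrightarrow> v x = 0" and "\<epsilon> > 0"
  obtains g where "continuous_on UNIV g" "\<And>x. \<bar>g x\<bar> \<le> K" "integrable lborel g"
    "(LINT x|lborel. \<bar>v x - g x\<bar>) < \<epsilon>"
proof -
  have K0: "0 \<le> K" using K[of 0] by linarith
  have "v measurable_on UNIV"
    by (rule lebesgue_measurable_imp_measurable_on) (auto simp: measurable_completion)
  then obtain N g where N: "negligible N" and g: "\<And>n. continuous_on UNIV (g n)"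
    and lim: "\<And>x. x \<notin> N \<Longrightarrow> (\<lambda>n. g n x) \<longlonglongrightarrow> v x"
    unfolding measurable_on_def by auto
  \<comment> \<open>Equal to 1 on the ball of radius \<open>R\<close>, where \<open>v\<close> lives, and to 0 outside radius \<open>R + 1\<close>.\<close>
  define cut where "cut x = max 0 (min 1 (R + 1 - dist c x))" for x
  define h where "h n x = max (- K) (min K (g n x)) * cut x" for n x
  have ch: "continuous_on UNIV (h n)" for n
    unfolding h_def cut_def by (intro continuous_intros g)
  have [measurable]: "h n \<in> borel_measurable borel" for n
    by (rule borel_measurable_continuous_onI[OF ch])
  have cut01: "0 \<le> cut x" "cut x \<le> 1" for x by (auto simp: cut_def)
  have hK: "\<bar>h n x\<bar> \<le> K" for n x
  proof -
    have "\<bar>max (- K) (min K (g n x))\<bar> \<le> K" using K0 by auto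
    then have "\<bar>h n x\<bar> \<le> K * 1"
      unfolding h_def abs_mult using cut01[of x] K0 by (intro mult_mono) auto
    then show ?thesis by simp
  qed
  have hsupp: "h n x = 0" if "x \<notin> cball c (R + 1)" for n x
    using that by (simp add: h_def cut_def)
  have hi: "integrable lborel (h n)" for n
    by (rule integrable_bounded_support[OF _ hK hsupp]) auto
  have "(\<lambda>n. LINT x|lborel. \<bar>v x - h n x\<bar>) \<longlonglongrightarrow> (LINT x|(lborel::(real^2) measure). 0)"
  proof (rule integral_dominated_convergence[where w = "\<lambda>x. 2 * K * indicator (cball c (R + 1)) x"])
    show "integrable lborel (\<lambda>x. 2 * K * indicat_real (cball c (R + 1)) x)"
      using K0 by (intro integrable_bounded_support[of _ "2 * K" c "R + 1"]) (auto simp: indicator_def)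
    have "AE x in lebesgue. x \<notin> N"
      using N by (simp add: negligible_iff_null_sets AE_not_in)
    then have "AE x in lborel. x \<notin> N" by (simp add: AE_completion_iff)
    then show "AE x in lborel. (\<lambda>n. \<bar>v x - h n x\<bar>) \<longlonglongrightarrow> 0"
    proof eventually_elim
      case (elim x)
      have "(\<lambda>n. \<bar>v x - h n x\<bar>) \<longlonglongrightarrow> \<bar>v x - max (- K) (min K (v x)) * cut x\<bar>"
        unfolding h_def by (intro tendsto_intros lim[OF elim])
      moreover have "max (- K) (min K (v x)) = v x" using K[of x] by (auto simp: max_def min_def)
      moreover have "v x * cut x = v x"
        using supp[of x] by (cases "x \<in> cball c R") (auto simp: cut_def)
      ultimately show ?case by simp
    qed
    show "AE x in lborel. norm \<bar>v x - h n x\<bar> \<le> 2 * K * indicator (cball c (R + 1)) x" for n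
    proof (intro AE_I2)
      fix x
      show "norm \<bar>v x - h n x\<bar> \<le> 2 * K * indicator (cball c (R + 1)) x"
        using K[of x] hK[of n x] hsupp[of x n] supp[of x] by (cases "x \<in> cball c (R + 1)") auto
    qed
  qed auto
  then have "(\<lambda>n. LINT x|lborel. \<bar>v x - h n x\<bar>) \<longlonglongrightarrow> 0" by simp
  then have "\<forall>\<^sub>F n in sequentially. (LINT x|lborel. \<bar>v x - h n x\<bar>) < \<epsilon>"
    using \<open>\<epsilon> > 0\<close> by (simp add: order_tendsto_iff)
  then obtain n where "(LINT x|lborel. \<bar>v x - h n x\<bar>) < \<epsilon>"
    by (auto simp: eventually_sequentially)
  with that[of "h n"] ch hK hi show thesis by blast
qed

lemma lint_affine:
  fixes f :: "real^2 \<Rightarrow> real"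
  assumes [measurable]: "f \<in> borel_measurable borel" and "c \<noteq> 0"
  shows "(LINT y|lborel. f y) = \<bar>c\<bar>^2 * (LINT w|lborel. f (t + c *\<^sub>R w))"
proof -
  have "(LINT y|lborel. f y) = (LINT y|density (distr lborel borel (\<lambda>x. t + c *\<^sub>R x)) (\<lambda>_. ennreal (\<bar>c\<bar>^2)). f y)"
    using lborel_affine[of c t] assms(2) by simp
  also have "\<dots> = (LINT w|lborel. \<bar>c\<bar>^2 * f (t + c *\<^sub>R w))"
    by (subst integral_density) (auto simp: integral_distr)
  finally show ?thesis by simp
qed

text \<open>If $v$ is continuous, the rescaled convolution converges pointwise and dominated convergence
applies. A general $v$ is replaced by a continuous $g$: the convolution of $u$ is bounded by $K$
uniformly in $n$, so the error is at most $2K \|v - g\|_{L^1}$.\<close>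
lemma approximate_identity:
  fixes u v \<rho> :: "real^2 \<Rightarrow> real"
  assumes [measurable]: "u \<in> borel_measurable borel" "v \<in> borel_measurable borel" "\<rho> \<in> borel_measurable borel"
    and uK: "\<And>x. \<bar>u x\<bar> \<le> K" and us: "\<And>x. x \<notin> cball c R \<Longrightarrow> u x = 0"
    and vK: "\<And>x. \<bar>v x\<bar> \<le> K" and vs: "\<And>x. x \<notin> cball c R \<Longrightarrow> v x = 0"
    and rb: "\<And>w. 0 \<le> \<rho> w" "\<And>w. \<rho> w \<le> b" and ri: "integrable lborel \<rho>" and r1: "(LINT w|lborel. \<rho> w) = 1"
  shows "(\<lambda>n. LINT y|lborel. v y * (LINT x|lborel. u x * ((Suc n)^2 * \<rho> (Suc n *\<^sub>R (x - y)))))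
     \<longlonglongrightarrow> (LINT x|lborel. u x * v x)"
proof -
  define \<rho>' where "\<rho>' n w = (real (Suc n))^2 * \<rho> (real (Suc n) *\<^sub>R w)" for n w
  have [measurable]: "\<rho>' n \<in> borel_measurable borel" for n unfolding \<rho>'_def by measurable
  have r'0: "0 \<le> \<rho>' n w" for n w using rb by (simp add: \<rho>'_def)
  have r'b: "\<bar>\<rho>' n w\<bar> \<le> (real (Suc n))^2 * b" for n w
    using rb by (simp add: \<rho>'_def abs_mult mult_left_mono)
  have K0: "0 \<le> K" using uK[of 0] by linarith
  have ui: "integrable lborel u" by (rule integrable_bounded_support[OF _ uK us]) auto
  have vi: "integrable lborel v" by (rule integrable_bounded_support[OF _ vK vs]) auto
  have scale: "(LINT x|lborel. f x * \<rho>' n (x - y)) = (LINT w|lborel. f (y + (1 / Suc n) *\<^sub>R w) * \<rho> w)"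
    if [measurable]: "f \<in> borel_measurable borel" for f n y
  proof -
    have "(LINT x|lborel. f x * \<rho>' n (x - y)) =
       \<bar>1 / Suc n\<bar>^2 * (LINT w|lborel. f (y + (1 / Suc n) *\<^sub>R w) * \<rho>' n (y + (1 / Suc n) *\<^sub>R w - y))"
      by (rule lint_affine) auto
    also have "\<dots> = (LINT w|lborel. f (y + (1 / Suc n) *\<^sub>R w) * \<rho> w)"
      by (subst integral_mult_right_zero[symmetric]) (simp add: \<rho>'_def power_divide del: of_nat_Suc)
    finally show ?thesis .
  qed
  have scale': "(LINT y|lborel. f y * \<rho>' n (x - y)) = (LINT w|lborel. f (x + (- 1 / Suc n) *\<^sub>R w) * \<rho> w)"
    if [measurable]: "f \<in> borel_measurable borel" for f n x
  proof -
    have "(LINT y|lborel. f y * \<rho>' n (x - y)) =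
       \<bar>- 1 / Suc n\<bar>^2 * (LINT w|lborel. f (x + (- 1 / Suc n) *\<^sub>R w) * \<rho>' n (x - (x + (- 1 / Suc n) *\<^sub>R w)))"
      by (rule lint_affine) auto
    also have "\<dots> = (LINT w|lborel. f (x + (- 1 / Suc n) *\<^sub>R w) * \<rho> w)"
      by (subst integral_mult_right_zero[symmetric]) (simp add: \<rho>'_def power_divide del: of_nat_Suc)
    finally show ?thesis .
  qed
  have ub: "\<bar>LINT x|lborel. u x * \<rho>' n (x - y)\<bar> \<le> K" for n y
    unfolding scale[OF assms(1)]
    using integral_mult_bound(2)[OF ri, of "\<lambda>w. u (y + (1 / Suc n) *\<^sub>R w)" K] uK r1 rb by (simp add: mult.commute)
  have swap: "(LINT y|lborel. f y * (LINT x|lborel. u x * \<rho>' n (x - y))) =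
      (LINT x|lborel. u x * (LINT y|lborel. f y * \<rho>' n (x - y)))" if "integrable lborel f" for f n
    by (rule charge_Fubini(2)[OF charge_density[OF ui] that _ r'b]) measurable
  have "(\<lambda>n. LINT y|lborel. v y * (LINT x|lborel. u x * \<rho>' n (x - y))) \<longlonglongrightarrow> (LINT x|lborel. u x * v x)"
  proof (rule LIMSEQ_I)
    fix \<epsilon> :: real assume "0 < \<epsilon>"
    \<comment> \<open>Two error terms of size \<open>K * D\<close> occur below; the added 1 avoids division by zero when \<open>K = 0\<close>.\<close>
    then have "0 < \<epsilon> / (2 * K + 1)" using K0 by simp
    then obtain g where cg: "continuous_on UNIV g" and gK: "\<And>x. \<bar>g x\<bar> \<le> K" and gi: "integrable lborel g"
      and gv: "(LINT x|lborel. \<bar>v x - g x\<bar>) < \<epsilon> / (2 * K + 1)"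
      using continuous_dense_L1[of v K c R "\<epsilon> / (2 * K + 1)"] vK vs by (auto simp: assms(2))
    have [measurable]: "g \<in> borel_measurable borel" by (rule borel_measurable_continuous_onI[OF cg])
    define D where "D = (LINT x|lborel. \<bar>v x - g x\<bar>)"
    have "(2 * K + 1) * D < \<epsilon>" using gv K0 by (simp add: D_def field_simps)
    moreover have D0: "0 \<le> D" by (simp add: D_def)
    ultimately have De: "2 * K * D < \<epsilon>" by (simp add: distrib_right)
    have gl: "(\<lambda>n. LINT y|lborel. g y * \<rho>' n (x - y)) \<longlonglongrightarrow> g x" for x
    proof -
      have "(\<lambda>n. LINT w|lborel. g (x + (- 1 / Suc n) *\<^sub>R w) * \<rho> w) \<longlonglongrightarrow> (LINT w|lborel. g x * \<rho> w)"
      proof (rule integral_dominated_convergence[where w = "\<lambda>w. K * \<rho> w"])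
        show "AE w in lborel. (\<lambda>n. g (x + (- 1 / Suc n) *\<^sub>R w) * \<rho> w) \<longlonglongrightarrow> g x * \<rho> w"
        proof (intro AE_I2 tendsto_mult tendsto_const)
          fix w
          have "(\<lambda>n. - (1 / real (Suc n))) \<longlonglongrightarrow> - 0"
            by (intro tendsto_minus lim_1_over_n[THEN LIMSEQ_Suc])
          then have "(\<lambda>n. x + (- 1 / Suc n) *\<^sub>R w) \<longlonglongrightarrow> x + 0 *\<^sub>R w"
            by (intro tendsto_intros) simp
          then show "(\<lambda>n. g (x + (- 1 / Suc n) *\<^sub>R w)) \<longlonglongrightarrow> g x"
            using cg by (intro isCont_tendsto_compose[of x g]) (auto simp: continuous_on_eq_continuous_at)
        qed
        show "AE w in lborel. norm (g (x + (- 1 / Suc n) *\<^sub>R w) * \<rho> w) \<le> K * \<rho> w" for n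
          using gK rb by (intro AE_I2) (simp add: abs_mult mult_right_mono)
      qed (use ri in auto)
      then show ?thesis unfolding scale'[OF \<open>g \<in> borel_measurable borel\<close>] by (simp add: r1)
    qed
    have gb: "\<bar>LINT y|lborel. g y * \<rho>' n (x - y)\<bar> \<le> K" for n x
      unfolding scale'[OF \<open>g \<in> borel_measurable borel\<close>]
      using integral_mult_bound(2)[OF ri, of "\<lambda>w. g (x + (- 1 / Suc n) *\<^sub>R w)" K] gK r1 rb by (simp add: mult.commute)
    have "(\<lambda>n. LINT x|lborel. u x * (LINT y|lborel. g y * \<rho>' n (x - y))) \<longlonglongrightarrow> (LINT x|lborel. u x * g x)"
    proof (rule integral_dominated_convergence[where w = "\<lambda>x. \<bar>u x\<bar> * K"])
      show "AE x in lborel. (\<lambda>n. u x * (LINT y|lborel. g y * \<rho>' n (x - y))) \<longlonglongrightarrow> u x * g x"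
        by (intro AE_I2 tendsto_mult tendsto_const gl)
      show "AE x in lborel. norm (u x * (LINT y|lborel. g y * \<rho>' n (x - y))) \<le> \<bar>u x\<bar> * K" for n
        using gb by (intro AE_I2) (simp add: abs_mult mult_left_mono)
    qed (use ui in auto)
    then have "\<forall>\<^sub>F n in sequentially. dist (LINT x|lborel. u x * (LINT y|lborel. g y * \<rho>' n (x - y)))
        (LINT x|lborel. u x * g x) < \<epsilon> - 2 * K * D"
      using De by (intro tendstoD) auto
    then obtain n0 where n0: "\<And>n. n \<ge> n0 \<Longrightarrow>
        \<bar>(LINT x|lborel. u x * (LINT y|lborel. g y * \<rho>' n (x - y))) - (LINT x|lborel. u x * g x)\<bar> < \<epsilon> - 2 * K * D"
      by (auto simp: eventually_sequentially dist_real_def)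
    show "\<exists>no. \<forall>n\<ge>no. norm ((LINT y|lborel. v y * (LINT x|lborel. u x * \<rho>' n (x - y))) -
        (LINT x|lborel. u x * v x)) < \<epsilon>"
    proof (intro exI allI impI)
      fix n assume "n \<ge> n0"
      let ?U = "\<lambda>y. LINT x|lborel. u x * \<rho>' n (x - y)"
      have Um: "?U \<in> borel_measurable borel" by measurable
      have dvi: "integrable lborel (\<lambda>y. v y - g y)" using vi gi by auto
      have 1: "\<bar>LINT y|lborel. (v y - g y) * ?U y\<bar> \<le> D * K"
        using integral_mult_bound(2)[OF dvi Um ub] by (simp add: D_def)
      have "(LINT y|lborel. (v y - g y) * ?U y) = (LINT y|lborel. v y * ?U y) - (LINT y|lborel. g y * ?U y)"
        using integral_mult_bound(1)[OF vi Um ub] integral_mult_bound(1)[OF gi Um ub] by (simp add: left_diff_distrib)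
      moreover have 2: "\<bar>LINT y|lborel. (v y - g y) * u y\<bar> \<le> D * K"
        using integral_mult_bound(2)[OF dvi _ uK] by (simp add: D_def)
      have "(LINT y|lborel. (v y - g y) * u y) = (LINT y|lborel. u y * v y) - (LINT y|lborel. u y * g y)"
        using integral_mult_bound(1)[OF vi assms(1) uK] integral_mult_bound(1)[OF gi assms(1) uK]
        by (simp add: left_diff_distrib mult.commute[of "u _"])
      ultimately show "norm ((LINT y|lborel. v y * ?U y) - (LINT x|lborel. u x * v x)) < \<epsilon>"
        using 1 2 n0[OF \<open>n \<ge> n0\<close>] swap[OF gi, of n] by (simp add: abs_if mult.commute split: if_splits)
    qed
  qed
  then show ?thesis by (simp add: \<rho>'_def)
qed

section \<open>Averages of differences along their own direction\<close>

lemma logistic_bounds: "0 < logistic t" "logistic t < 1"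
  by (auto simp: logistic_def add_pos_pos)

lemma continuous_on_logistic: "continuous_on UNIV logistic"
  by (meson logistic_deriv DERIV_isCont continuous_at_imp_continuous_on)

lemma logistic_measurable [measurable]: "logistic \<in> borel_measurable borel"
  by (rule borel_measurable_continuous_onI[OF continuous_on_logistic])

definition logistic_density :: "real \<Rightarrow> real" where
  "logistic_density t = logistic t * (1 - logistic t)"

lemma logistic_density_measurable [measurable]: "logistic_density \<in> borel_measurable borel"
  unfolding logistic_density_def by measurable

lemma logistic_density_bounds: "0 \<le> logistic_density t" "logistic_density t \<le> 1"
  unfolding logistic_density_def using logistic_bounds[of t]
  by (auto intro!: mult_nonneg_nonneg mult_le_one)

lemma nn_integral_logistic_density: "(\<integral>\<^sup>+t. ennreal (logistic_density t) \<partial>lborel) = 1"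
proof -
  have D: "((\<lambda>t. - logistic t) has_real_derivative logistic_density t) (at t)" for t
    using DERIV_minus[OF logistic_deriv] by (simp add: logistic_density_def)
  have c: "isCont logistic_density t" for t
    unfolding logistic_density_def using continuous_on_logistic
    by (auto simp: continuous_on_eq_continuous_at intro!: continuous_intros)
  have 1: "(logistic \<longlongrightarrow> 0) at_top"
  proof -
    have "LIM t at_top. 1 + exp (t::real) :> at_top"
      by (intro filterlim_tendsto_add_at_top[OF tendsto_const] exp_at_top)
    then show ?thesis unfolding logistic_def[abs_def]
      by (intro tendsto_divide_0[OF tendsto_const] filterlim_at_top_imp_at_infinity)
  qed
  have "((\<lambda>t. 1 / (1 + exp t)) \<longlongrightarrow> 1 / (1 + (0::real))) at_bot"
    by (intro tendsto_intros exp_at_bot) auto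
  then have 2: "(logistic \<longlongrightarrow> 1) at_bot" by (simp add: logistic_def[abs_def])
  have *: "set_integrable lborel (einterval (-\<infinity>) \<infinity>) logistic_density"
    "(LBINT t=-\<infinity>..\<infinity>. logistic_density t) = - 0 - (- 1)"
    using tendsto_minus[OF 1] tendsto_minus[OF 2] logistic_density_bounds
    by (intro interval_integral_FTC_nonneg[where F = "\<lambda>t. - logistic t"];
        auto intro!: D c simp: ereal_tendsto_simps1)+
  then have "integrable lborel logistic_density" "(LINT t|lborel. logistic_density t) = 1"
    by (auto simp: set_integrable_def interval_lebesgue_integral_def set_lebesgue_integral_def einterval_def)
  then show ?thesis using logistic_density_bounds
    by (subst nn_integral_eq_integral) auto
qed

lemma nn_integral_scaled_density:
  assumes [measurable]: "r \<in> borel_measurable borel" and "(\<integral>\<^sup>+t. ennreal (r t) \<partial>lborel) = 1"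
    and "c \<noteq> 0" and "\<And>t. 0 \<le> r t"
  shows "(\<integral>\<^sup>+t. ennreal (\<bar>c\<bar> * r (a + c * t)) \<partial>lborel) = 1"
  using nn_integral_real_affine[of "\<lambda>t. ennreal (r t)" c a] assms
  by (simp add: ennreal_mult nn_integral_cmult)

text \<open>The difference is the integral of $r$ over a window of length $h$, and exchanging the two
integrations leaves the length of the window.\<close>
lemma nn_integral_shift_decreasing:
  assumes D: "\<And>t. (f has_real_derivative - r t) (at t)" and [measurable]: "r \<in> borel_measurable borel"
    and r: "\<And>t. 0 \<le> r t" "(\<integral>\<^sup>+t. ennreal (r t) \<partial>lborel) = 1" and h: "0 \<le> h"
  shows "(\<integral>\<^sup>+t. ennreal \<bar>f (t - h) - f t\<bar> \<partial>lborel) = ennreal h"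
proof -
  have eq: "ennreal \<bar>f (t - h) - f t\<bar> = (\<integral>\<^sup>+s. ennreal (r (t - s)) * indicator {0..h} s \<partial>lborel)" for t
  proof -
    have D': "((\<lambda>s. f (t - s)) has_real_derivative r (t - s)) (at s)" for s
    proof -
      have "((\<lambda>s. t - s) has_real_derivative - 1) (at s)" by (auto intro!: derivative_eq_intros)
      from DERIV_chain'[where g = f, OF this D[of "t - s"]] show ?thesis by simp
    qed
    have "(\<integral>\<^sup>+s. ennreal (r (t - s)) * indicator {0..h} s \<partial>lborel) = ennreal (f (t - h) - f (t - 0))"
      using h r by (intro nn_integral_FTC_Icc) (auto intro!: D')
    moreover have "f t \<le> f (t - h)"
    proof (rule DERIV_nonpos_imp_nonincreasing[where f = f and a = "t - h" and b = t])
      show "t - h \<le> t" using h by simp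
      show "\<exists>y. DERIV f x :> y \<and> y \<le> 0" for x using D[of x] r by (intro exI[of _ "- r x"]) auto
    qed
    ultimately show ?thesis by simp
  qed
  have "(\<integral>\<^sup>+t. ennreal \<bar>f (t - h) - f t\<bar> \<partial>lborel)
      = (\<integral>\<^sup>+s. (\<integral>\<^sup>+t. ennreal (r (t - s)) * indicator {0..h} s \<partial>lborel) \<partial>lborel)"
    unfolding eq by (rule lborel_pair.Fubini'[symmetric]) measurable
  also have "\<dots> = (\<integral>\<^sup>+s. indicator {0..h} s \<partial>lborel)"
  proof (rule nn_integral_cong)
    fix s
    have "(\<integral>\<^sup>+t. ennreal (r (t - s)) \<partial>lborel) = 1"
      using nn_integral_scaled_density[OF assms(2) r(2), of 1 "- s"] r by simp
    then show "(\<integral>\<^sup>+t. ennreal (r (t - s)) * indicator {0..h} s \<partial>lborel) = indicator {0..h} s"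
      by (simp add: nn_integral_multc)
  qed
  also have "\<dots> = ennreal h" using h by simp
  finally show ?thesis .
qed

text \<open>Moving the translation by $h e$ from $\phi$ to the other two factors leaves $\phi$ times the
increment of $\eta(x)\, f(x \cdot e)\, g(x \cdot n)$. The factor $g$ does not see the translation. The
increment of $\eta$ is at most $L h$ on a strip of width $2(R + 1)$, and the increment of $f$ has
integral at most $h$; since $g$ has integral one, both contributions are $O(h)$, however
concentrated $g$ is.\<close>
lemma oscillation_along_direction:
  fixes \<phi> \<eta> :: "real^2 \<Rightarrow> real"
  assumes e: "norm e = 1" and h: "0 \<le> h" "h \<le> 1"
    and [measurable]: "\<phi> \<in> borel_measurable borel" "\<eta> \<in> borel_measurable borel"
      "f \<in> borel_measurable borel" "g \<in> borel_measurable borel"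
    and \<phi>: "\<And>x. \<bar>\<phi> x\<bar> \<le> M"
    and \<eta>: "\<And>x. \<bar>\<eta> x\<bar> \<le> X" "\<And>x. x \<notin> cball c R \<Longrightarrow> \<eta> x = 0" "\<And>x y. \<bar>\<eta> x - \<eta> y\<bar> \<le> L * dist x y"
    and R: "0 \<le> R"
    and f: "\<And>t. 0 \<le> f t" "\<And>t. f t \<le> 1" "(\<integral>\<^sup>+t. ennreal \<bar>f (t - h) - f t\<bar> \<partial>lborel) \<le> ennreal h"
    and g: "\<And>t. 0 \<le> g t" "\<And>t. g t \<le> b" "(\<integral>\<^sup>+t. ennreal (g t) \<partial>lborel) = 1"
  shows "\<bar>LINT x|lborel. \<eta> x * (\<phi> (x + h *\<^sub>R e) - \<phi> x) * (f (x \<bullet> e) * g (x \<bullet> rot e))\<bar>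
     \<le> M * (2 * L * (R + 1) + X) * h"
proof -
  define k where "k x = f (x \<bullet> e) * g (x \<bullet> rot e)" for x
  have [measurable]: "k \<in> borel_measurable borel" unfolding k_def by measurable
  have M0: "0 \<le> M" using \<phi>[of 0] by linarith
  have X0: "0 \<le> X" using \<eta>(1)[of 0] by linarith
  have b0: "0 \<le> b" using g(1,2)[of 0] by linarith
  have L0: "0 \<le> L" using \<eta>(3)[of 0 "axis 1 1"] by (auto simp: zero_le_mult_iff dest: order_trans[OF abs_ge_zero])
  have k0: "0 \<le> k x" for x using f g by (simp add: k_def)
  have kb: "\<bar>k x\<bar> \<le> b" for x
    using mult_mono[of "f (x \<bullet> e)" 1 "g (x \<bullet> rot e)" b] f g by (simp add: k_def abs_mult)
  have ee: "e \<bullet> e = 1" using e by (simp add: norm_eq_1)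
  have en: "e \<bullet> rot e = 0" by (simp add: inner_vec2 rot_def)
  let ?z = "h *\<^sub>R e"
  have i1: "integrable lborel (\<lambda>x. \<eta> x * \<phi> (x + ?z) * k x)" (is "integrable lborel ?a")
  proof (rule integrable_bounded_support[of _ "X * M * b" c R])
    show "\<bar>\<eta> x * \<phi> (x + ?z) * k x\<bar> \<le> X * M * b" for x
      unfolding abs_mult using \<eta>(1) \<phi> kb X0 M0 by (intro mult_mono) auto
  qed (use \<eta> in auto)
  have i2: "integrable lborel (\<lambda>x. \<eta> x * \<phi> x * k x)"
  proof (rule integrable_bounded_support[of _ "X * M * b" c R])
    show "\<bar>\<eta> x * \<phi> x * k x\<bar> \<le> X * M * b" for x
      unfolding abs_mult using \<eta>(1) \<phi> kb X0 M0 by (intro mult_mono) auto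
  qed (use \<eta> in auto)
  have "integrable (distr lborel borel ((+) (- ?z))) ?a"
    using i1 by (simp add: lborel_distr_plus)
  then have i1': "integrable lborel (\<lambda>x. ?a (- ?z + x))"
    by (subst (asm) integrable_distr_eq) auto
  have "integral\<^sup>L lborel ?a = integral\<^sup>L (distr lborel borel ((+) (- ?z))) ?a"
    by (simp add: lborel_distr_plus)
  also have "\<dots> = (LINT x|lborel. ?a (- ?z + x))"
    by (rule integral_distr) auto
  finally have shift: "integral\<^sup>L lborel ?a = (LINT x|lborel. ?a (- ?z + x))" .
  let ?d = "\<lambda>x. \<phi> x * (\<eta> (x - ?z) * k (x - ?z) - \<eta> x * k x)"
  have deq: "?d x = ?a (- ?z + x) - \<eta> x * \<phi> x * k x" for x by (simp add: algebra_simps)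
  have di: "integrable lborel ?d" unfolding deq by (intro Bochner_Integration.integrable_diff i1' i2)
  have "(LINT x|lborel. \<eta> x * (\<phi> (x + ?z) - \<phi> x) * k x) = (LINT x|lborel. ?a x - \<eta> x * \<phi> x * k x)"
    by (simp add: algebra_simps)
  also have "\<dots> = (LINT x|lborel. ?d x)"
    unfolding deq using i1 i1' i2 shift by simp
  finally have eq: "(LINT x|lborel. \<eta> x * (\<phi> (x + ?z) - \<phi> x) * k x) = (LINT x|lborel. ?d x)" .
  let ?I = "\<lambda>t. indicat_real {c \<bullet> e - (R + 1)..c \<bullet> e + (R + 1)} t"
  let ?P = "\<lambda>t. M * (L * h) * ?I t + M * X * \<bar>f (t - h) - f t\<bar>"
  have bound: "\<bar>?d x\<bar> \<le> ?P (x \<bullet> e) * g (x \<bullet> rot e)" for x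
  proof -
    have k': "k (x - ?z) = f (x \<bullet> e - h) * g (x \<bullet> rot e)"
      by (simp add: k_def inner_diff_left ee en)
    have "\<bar>\<eta> (x - ?z) - \<eta> x\<bar> \<le> L * h * ?I (x \<bullet> e)"
    proof (cases "x \<in> cball c (R + 1)")
      case True
      have "\<bar>(x - c) \<bullet> e\<bar> \<le> R + 1"
        using Cauchy_Schwarz_ineq2[of "x - c" e] True e by (simp add: dist_norm norm_minus_commute)
      then have "?I (x \<bullet> e) = 1" by (auto simp: indicator_def inner_diff_left)
      then show ?thesis using \<eta>(3)[of "x - ?z" x] e h by (simp add: dist_norm)
    next
      case False
      have "dist c x \<le> dist c (x - ?z) + dist (x - ?z) x" by (rule dist_triangle)
      then have "x - ?z \<notin> cball c R" "x \<notin> cball c R" using False e h by (auto simp: dist_norm)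
      then show ?thesis using \<eta>(2) L0 h by simp
    qed
    then have 1: "\<bar>\<eta> (x - ?z) - \<eta> x\<bar> * k (x - ?z) \<le> L * h * ?I (x \<bullet> e) * g (x \<bullet> rot e)"
      unfolding k' using f g L0 h
      by (intro mult_mono) (auto intro!: mult_nonneg_nonneg mult_left_le_one_le)
    have 2: "\<bar>\<eta> x\<bar> * \<bar>k (x - ?z) - k x\<bar> \<le> X * (\<bar>f (x \<bullet> e - h) - f (x \<bullet> e)\<bar> * g (x \<bullet> rot e))"
    proof -
      have "k (x - ?z) - k x = (f (x \<bullet> e - h) - f (x \<bullet> e)) * g (x \<bullet> rot e)"
        unfolding k' by (simp add: k_def left_diff_distrib)
      then have "\<bar>k (x - ?z) - k x\<bar> = \<bar>f (x \<bullet> e - h) - f (x \<bullet> e)\<bar> * g (x \<bullet> rot e)"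
        using g by (simp add: abs_mult)
      then show ?thesis using \<eta>(1)[of x] g by (auto intro!: mult_right_mono mult_nonneg_nonneg)
    qed
    have "\<eta> (x - ?z) * k (x - ?z) - \<eta> x * k x = (\<eta> (x - ?z) - \<eta> x) * k (x - ?z) + \<eta> x * (k (x - ?z) - k x)"
      by (simp add: algebra_simps)
    then have "\<bar>\<eta> (x - ?z) * k (x - ?z) - \<eta> x * k x\<bar>
        \<le> \<bar>\<eta> (x - ?z) - \<eta> x\<bar> * k (x - ?z) + \<bar>\<eta> x\<bar> * \<bar>k (x - ?z) - k x\<bar>"
      using abs_triangle_ineq[of "(\<eta> (x - ?z) - \<eta> x) * k (x - ?z)" "\<eta> x * (k (x - ?z) - k x)"] k0[of "x - ?z"]
      by (simp only: abs_mult abs_of_nonneg)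
    also note add_mono[OF 1 2]
    finally have "\<bar>?d x\<bar> \<le> M * (L * h * ?I (x \<bullet> e) * g (x \<bullet> rot e) + X * (\<bar>f (x \<bullet> e - h) - f (x \<bullet> e)\<bar> * g (x \<bullet> rot e)))"
      unfolding abs_mult using \<phi>[of x] M0 by (intro mult_mono) auto
    then show ?thesis by (simp add: algebra_simps)
  qed
  have P0: "0 \<le> ?P t" for t using M0 L0 X0 h by simp
  have "ennreal \<bar>LINT x|lborel. ?d x\<bar> \<le> (\<integral>\<^sup>+x. ennreal \<bar>?d x\<bar> \<partial>lborel)"
    using integral_norm_bound_ennreal[OF di] by simp
  also have "\<dots> \<le> (\<integral>\<^sup>+x. ennreal (?P (x \<bullet> e)) * ennreal (g (x \<bullet> rot e)) \<partial>lborel)"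
    using bound P0 g by (intro nn_integral_mono) (simp add: ennreal_mult[symmetric] ennreal_leI)
  also have "\<dots> = (\<integral>\<^sup>+t. ennreal (?P t) \<partial>lborel) * (\<integral>\<^sup>+t. ennreal (g t) \<partial>lborel)"
    by (rule nn_integral_frame[OF e]) auto
  also have "\<dots> = (\<integral>\<^sup>+t. ennreal (M * (L * h)) * ennreal (?I t) + ennreal (M * X) * ennreal \<bar>f (t - h) - f t\<bar> \<partial>lborel)"
    using M0 L0 X0 h g(3) by (simp add: ennreal_plus ennreal_mult)
  also have "\<dots> = ennreal (M * (L * h)) * (\<integral>\<^sup>+t. ennreal (?I t) \<partial>lborel)
      + ennreal (M * X) * (\<integral>\<^sup>+t. ennreal \<bar>f (t - h) - f t\<bar> \<partial>lborel)"
    by (subst nn_integral_add) (auto simp: nn_integral_cmult)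
  also have "(\<integral>\<^sup>+t. ennreal (?I t) \<partial>lborel) = ennreal (2 * (R + 1))"
    using R by (simp add: ennreal_indicator)
  also have "ennreal (M * (L * h)) * ennreal (2 * (R + 1)) + ennreal (M * X) * (\<integral>\<^sup>+t. ennreal \<bar>f (t - h) - f t\<bar> \<partial>lborel)
     \<le> ennreal (M * (L * h)) * ennreal (2 * (R + 1)) + ennreal (M * X) * ennreal h"
    by (intro add_left_mono mult_left_mono f(3)) auto
  also have "\<dots> = ennreal (M * (2 * L * (R + 1) + X) * h)"
    using M0 L0 X0 h R by (simp add: ennreal_mult[symmetric] ennreal_plus[symmetric] algebra_simps del: ennreal_plus)
  finally have "\<bar>LINT x|lborel. ?d x\<bar> \<le> M * (2 * L * (R + 1) + X) * h"
    using M0 L0 X0 h R by (subst (asm) ennreal_le_iff) auto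
  then show ?thesis using eq by (simp add: k_def)
qed

section \<open>The interaction identity\<close>

lemma smooth_affine_arg:
  assumes "smooth_real f"
  shows "smooth (\<lambda>x. f (x \<bullet> v + a))"
  by (rule smooth_compose[OF assms]) (simp add: Ck_add Ck_inner Ck_const)

lemma smooth_mult: "smooth f \<Longrightarrow> smooth g \<Longrightarrow> smooth (\<lambda>x. f x * g x)"
  by (simp add: Ck_mult)

lemma grad_frame_product:
  fixes v w :: "real^2"
  assumes "(f has_real_derivative f') (at (x \<bullet> v + a))" "(g has_real_derivative g') (at (x \<bullet> w + b))"
  shows "grad (\<lambda>x. f (x \<bullet> v + a) * g (x \<bullet> w + b)) x
    = (f' * g (x \<bullet> w + b)) *\<^sub>R v + (f (x \<bullet> v + a) * g') *\<^sub>R w"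
proof (rule grad_eqI)
  have 1: "((\<lambda>x. f (x \<bullet> v + a)) has_derivative (\<lambda>h. f' * (h \<bullet> v))) (at x)"
  proof -
    have "((\<lambda>x. x \<bullet> v + a) has_derivative (\<lambda>h. h \<bullet> v)) (at x)" by (auto intro!: derivative_eq_intros)
    from has_derivative_compose[OF this assms(1)[unfolded has_field_derivative_def]] show ?thesis by simp
  qed
  have 2: "((\<lambda>x. g (x \<bullet> w + b)) has_derivative (\<lambda>h. g' * (h \<bullet> w))) (at x)"
  proof -
    have "((\<lambda>x. x \<bullet> w + b) has_derivative (\<lambda>h. h \<bullet> w)) (at x)" by (auto intro!: derivative_eq_intros)
    from has_derivative_compose[OF this assms(2)[unfolded has_field_derivative_def]] show ?thesis by simp
  qed
  show "((\<lambda>x. f (x \<bullet> v + a) * g (x \<bullet> w + b)) has_derivative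
      (\<bullet>) ((f' * g (x \<bullet> w + b)) *\<^sub>R v + (f (x \<bullet> v + a) * g') *\<^sub>R w)) (at x)"
    using has_derivative_mult[OF 1 2]
    by (rule has_derivative_eq_rhs) (auto simp: fun_eq_iff inner_add_left inner_commute algebra_simps)
qed

text \<open>With $k(w) = f(w \cdot e)\, g(w \cdot n)$, testing the divergence of $A$ with $x \mapsto k(x - y)$ expresses
$\int (A \cdot e)\, \partial_e k$ through $\Lambda_A$ and $\int (A \cdot n)\, \partial_n k$. Testing
the divergence of $B$ with $y \mapsto k(x - y)$ does the same for $B$. After multiplication by
$B \cdot n$ and $A \cdot n$ and integration, both remainders equal
$\iint (A \cdot n)(x)\, (B \cdot n)(y)\, \partial_n k(x - y)$ and cancel in the difference.\<close>
lemma wedge_kernel_identity: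
  fixes A B :: "real^2 \<Rightarrow> real^2"
  assumes int: "integrable lborel (\<lambda>x. A x \<bullet> e)" "integrable lborel (\<lambda>x. A x \<bullet> rot e)"
      "integrable lborel (\<lambda>x. B x \<bullet> e)" "integrable lborel (\<lambda>x. B x \<bullet> rot e)"
    and \<Lambda>: "charge \<Lambda>\<^sub>A C\<^sub>A" "charge \<Lambda>\<^sub>B C\<^sub>B"
    and div: "\<And>\<psi>. smooth \<psi> \<Longrightarrow> (LINT x|lborel. A x \<bullet> grad \<psi> x) = - \<Lambda>\<^sub>A \<psi>"
      "\<And>\<psi>. smooth \<psi> \<Longrightarrow> (LINT x|lborel. B x \<bullet> grad \<psi> x) = - \<Lambda>\<^sub>B \<psi>"
    and sm: "smooth_real f" "smooth_real g"
    and f': "\<And>t. (f has_real_derivative f' t) (at t)" and g': "\<And>t. (g has_real_derivative g' t) (at t)"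
    and meas[measurable]: "f' \<in> borel_measurable borel" "g' \<in> borel_measurable borel"
    and bd: "\<And>t. \<bar>f t\<bar> \<le> c" "\<And>t. \<bar>f' t\<bar> \<le> c" "\<And>t. \<bar>g t\<bar> \<le> c" "\<And>t. \<bar>g' t\<bar> \<le> c"
  shows "(LINT y|lborel. (B y \<bullet> rot e) * (LINT x|lborel. (A x \<bullet> e) * (f' ((x - y) \<bullet> e) * g ((x - y) \<bullet> rot e))))
     - (LINT y|lborel. (B y \<bullet> e) * (LINT x|lborel. (A x \<bullet> rot e) * (f' ((x - y) \<bullet> e) * g ((x - y) \<bullet> rot e))))
     = - \<Lambda>\<^sub>A (\<lambda>x. LINT y|lborel. (B y \<bullet> rot e) * (f ((x - y) \<bullet> e) * g ((x - y) \<bullet> rot e)))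
       - \<Lambda>\<^sub>B (\<lambda>y. LINT x|lborel. (A x \<bullet> rot e) * (f ((x - y) \<bullet> e) * g ((x - y) \<bullet> rot e)))"
proof -
  have [measurable]: "f \<in> borel_measurable borel" "g \<in> borel_measurable borel"
    using f' g' by (meson DERIV_isCont borel_measurable_continuous_onI continuous_at_imp_continuous_on)+
  define k where "k w = f (w \<bullet> e) * g (w \<bullet> rot e)" for w
  define ke where "ke w = f' (w \<bullet> e) * g (w \<bullet> rot e)" for w
  define kn where "kn w = f (w \<bullet> e) * g' (w \<bullet> rot e)" for w
  have [measurable]: "k \<in> borel_measurable borel" "ke \<in> borel_measurable borel" "kn \<in> borel_measurable borel"
    unfolding k_def ke_def kn_def by measurable
  have c0: "0 \<le> c" using bd(1)[of 0] by linarith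
  have kb: "\<bar>k w\<bar> \<le> c * c" "\<bar>ke w\<bar> \<le> c * c" "\<bar>kn w\<bar> \<le> c * c" for w
    unfolding k_def ke_def kn_def abs_mult using bd c0 by (auto intro!: mult_mono)
  define Ae where "Ae x = A x \<bullet> e" for x
  define An where "An x = A x \<bullet> rot e" for x
  define Be where "Be x = B x \<bullet> e" for x
  define Bn where "Bn x = B x \<bullet> rot e" for x
  note int = int[folded Ae_def An_def Be_def Bn_def]
  have IA: "(LINT x|lborel. Ae x * ke (x - y)) = - \<Lambda>\<^sub>A (\<lambda>x. k (x - y)) - (LINT x|lborel. An x * kn (x - y))" for y
  proof -
    have k_eq: "(\<lambda>x. k (x - y)) = (\<lambda>x. f (x \<bullet> e + - (y \<bullet> e)) * g (x \<bullet> rot e + - (y \<bullet> rot e)))"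
      by (simp add: k_def inner_diff_left)
    have "smooth (\<lambda>x. k (x - y))"
      unfolding k_eq by (intro smooth_mult smooth_affine_arg sm)
    note div(1)[OF this]
    moreover have "grad (\<lambda>x. k (x - y)) x = ke (x - y) *\<^sub>R e + kn (x - y) *\<^sub>R rot e" for x
      unfolding k_eq
      using grad_frame_product[OF f' g', where v = e and w = "rot e" and a = "- (y \<bullet> e)" and b = "- (y \<bullet> rot e)"]
      by (simp add: ke_def kn_def inner_diff_left)
    moreover have "integrable lborel (\<lambda>x. Ae x * ke (x - y))" "integrable lborel (\<lambda>x. An x * kn (x - y))"
      by (rule integral_mult_bound(1)[OF int(1) _ kb(2)], measurable) (rule integral_mult_bound(1)[OF int(2) _ kb(3)], measurable)
    ultimately show ?thesis by (simp add: inner_add_right Ae_def An_def mult.commute)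
  qed
  have IB: "(LINT y|lborel. Be y * ke (x - y)) = \<Lambda>\<^sub>B (\<lambda>y. k (x - y)) - (LINT y|lborel. Bn y * kn (x - y))" for x
  proof -
    have k_eq: "(\<lambda>y. k (x - y)) = (\<lambda>y. f (y \<bullet> - e + x \<bullet> e) * g (y \<bullet> - rot e + x \<bullet> rot e))"
      by (simp add: k_def inner_diff_left)
    have "smooth (\<lambda>y. k (x - y))"
      unfolding k_eq by (intro smooth_mult smooth_affine_arg sm)
    note div(2)[OF this]
    moreover have "grad (\<lambda>y. k (x - y)) y = - (ke (x - y) *\<^sub>R e + kn (x - y) *\<^sub>R rot e)" for y
      unfolding k_eq using grad_frame_product[OF f' g', where v = "- e" and w = "- rot e" and a = "x \<bullet> e" and b = "x \<bullet> rot e"]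
      by (simp add: ke_def kn_def inner_diff_left)
    moreover have "integrable lborel (\<lambda>y. Be y * ke (x - y))" "integrable lborel (\<lambda>y. Bn y * kn (x - y))"
      by (rule integral_mult_bound(1)[OF int(3) _ kb(2)], measurable) (rule integral_mult_bound(1)[OF int(4) _ kb(3)], measurable)
    ultimately show ?thesis by (simp add: inner_diff_right Be_def Bn_def mult.commute)
  qed
  have swap: "(LINT y|lborel. v y * (LINT x|lborel. u x * K (x - y))) = (LINT x|lborel. u x * (LINT y|lborel. v y * K (x - y)))"
    "integrable lborel (\<lambda>y. v y * (LINT x|lborel. u x * K (x - y)))"
    if "integrable lborel u" "integrable lborel v" "K \<in> borel_measurable borel" "\<And>w. \<bar>K w\<bar> \<le> c * c" for u v K :: "real^2 \<Rightarrow> real"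
  proof -
    have [measurable]: "K \<in> borel_measurable borel" by fact
    show "(LINT y|lborel. v y * (LINT x|lborel. u x * K (x - y))) = (LINT x|lborel. u x * (LINT y|lborel. v y * K (x - y)))"
      "integrable lborel (\<lambda>y. v y * (LINT x|lborel. u x * K (x - y)))"
      using charge_Fubini[OF charge_density[OF that(1)] that(2) _ that(4), of "\<lambda>x y. x - y"] by simp_all
  qed
  have FA: "integrable lborel (\<lambda>y. Bn y * \<Lambda>\<^sub>A (\<lambda>x. k (x - y)))"
    "(LINT y|lborel. Bn y * \<Lambda>\<^sub>A (\<lambda>x. k (x - y))) = \<Lambda>\<^sub>A (\<lambda>x. LINT y|lborel. Bn y * k (x - y))"
    using charge_Fubini[OF \<Lambda>(1) int(4) _ kb(1), of "\<lambda>x y. x - y"] by simp_all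
  have FB: "integrable lborel (\<lambda>x. An x * \<Lambda>\<^sub>B (\<lambda>y. k (x - y)))"
    "(LINT x|lborel. An x * \<Lambda>\<^sub>B (\<lambda>y. k (x - y))) = \<Lambda>\<^sub>B (\<lambda>y. LINT x|lborel. An x * k (x - y))"
    using charge_Fubini[OF \<Lambda>(2) int(2) _ kb(1), of "\<lambda>y x. x - y"] by simp_all
  note kn_meas = \<open>kn \<in> borel_measurable borel\<close> and ke_meas = \<open>ke \<in> borel_measurable borel\<close>
  \<comment> \<open>The roles of the two variables are exchanged, hence the reflected kernel.\<close>
  have i: "integrable lborel (\<lambda>x. An x * (LINT y|lborel. Bn y * kn (x - y)))"
    using swap(2)[OF int(4) int(2), of "\<lambda>w. kn (- w)"] kb(3) by simp
  have "(LINT y|lborel. Bn y * (LINT x|lborel. Ae x * ke (x - y)))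
      = - \<Lambda>\<^sub>A (\<lambda>x. LINT y|lborel. Bn y * k (x - y)) - (LINT y|lborel. Bn y * (LINT x|lborel. An x * kn (x - y)))"
    unfolding IA using FA swap(2)[OF int(2) int(4) kn_meas kb(3)] by (simp add: right_diff_distrib)
  moreover have "(LINT y|lborel. Be y * (LINT x|lborel. An x * ke (x - y)))
      = \<Lambda>\<^sub>B (\<lambda>y. LINT x|lborel. An x * k (x - y)) - (LINT x|lborel. An x * (LINT y|lborel. Bn y * kn (x - y)))"
    unfolding swap(1)[OF int(2) int(3) ke_meas kb(2)] IB using FB i by (simp add: right_diff_distrib)
  moreover note swap(1)[OF int(2) int(4) kn_meas kb(3)]
  ultimately show ?thesis unfolding Ae_def An_def Be_def Bn_def k_def ke_def by simp
qed

text \<open>The identity is applied with the kernel $\ell(d t)\, d\, r(d t')$, where $t$ and $t'$ are the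
coordinates along and across $e$, $\ell$ is the logistic step and $r = -\ell'$. Its derivative along
$e$ is $-d^2 \rho(d w)$ for the probability density $\rho(w) = r(t)\, r(t')$, so the left-hand
side converges to $\int A \wedge B$ as $d \to \infty$, while the right-hand side is bounded
uniformly in $d$.\<close>
lemma wedge_integral_bound:
  fixes A B :: "real^2 \<Rightarrow> real^2"
  assumes e: "norm e = 1"
    and [measurable]: "A \<in> borel_measurable borel" "B \<in> borel_measurable borel"
    and bd: "\<And>x. norm (A x) \<le> K" "\<And>x. norm (B x) \<le> K"
    and supp: "\<And>x. x \<notin> cball c R \<Longrightarrow> A x = 0" "\<And>x. x \<notin> cball c R \<Longrightarrow> B x = 0"
    and \<Lambda>: "charge \<Lambda>\<^sub>A C\<^sub>A" "charge \<Lambda>\<^sub>B C\<^sub>B"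
    and div: "\<And>\<psi>. smooth \<psi> \<Longrightarrow> (LINT x|lborel. A x \<bullet> grad \<psi> x) = - \<Lambda>\<^sub>A \<psi>"
      "\<And>\<psi>. smooth \<psi> \<Longrightarrow> (LINT x|lborel. B x \<bullet> grad \<psi> x) = - \<Lambda>\<^sub>B \<psi>"
    and S: "\<And>d x. 0 < d \<Longrightarrow> \<bar>LINT y|lborel. (B y \<bullet> rot e) *
          (logistic (d * ((x - y) \<bullet> e)) * (d * logistic_density (d * ((x - y) \<bullet> rot e))))\<bar> \<le> S"
      "\<And>d y. 0 < d \<Longrightarrow> \<bar>LINT x|lborel. (A x \<bullet> rot e) *
          (logistic (d * ((x - y) \<bullet> e)) * (d * logistic_density (d * ((x - y) \<bullet> rot e))))\<bar> \<le> S"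
  shows "\<bar>LINT x|lborel. (A x \<bullet> e) * (B x \<bullet> rot e) - (A x \<bullet> rot e) * (B x \<bullet> e)\<bar> \<le> (C\<^sub>A + C\<^sub>B) * S"
proof -
  have ne: "norm (rot e) = 1" using e by (simp add: norm_eq_sqrt_inner inner_vec2 rot_def add.commute)
  have comp: "\<bar>A x \<bullet> v\<bar> \<le> K" "\<bar>B x \<bullet> v\<bar> \<le> K" if "norm v = 1" for x v
    using Cauchy_Schwarz_ineq2[of "A x" v] Cauchy_Schwarz_ineq2[of "B x" v] bd[of x] that by auto
  have suppc: "x \<notin> cball c R \<Longrightarrow> A x \<bullet> v = 0" "x \<notin> cball c R \<Longrightarrow> B x \<bullet> v = 0" for x v
    using supp by auto
  have int: "integrable lborel (\<lambda>x. A x \<bullet> v)" "integrable lborel (\<lambda>x. B x \<bullet> v)" if "norm v = 1" for v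
    by (rule integrable_bounded_support[OF _ comp(1)[OF that] suppc(1)], measurable)
       (rule integrable_bounded_support[OF _ comp(2)[OF that] suppc(2)], measurable)
  define \<rho> where "\<rho> w = logistic_density (w \<bullet> e) * logistic_density (w \<bullet> rot e)" for w
  have \<rho>m: "\<rho> \<in> borel_measurable borel" unfolding \<rho>_def by measurable
  have \<rho>b: "0 \<le> \<rho> w" "\<rho> w \<le> 1" for w
    unfolding \<rho>_def using logistic_density_bounds by (auto intro!: mult_le_one)
  have "(\<integral>\<^sup>+w. ennreal (\<rho> w) \<partial>lborel) = 1"
    using nn_integral_frame[OF e, of "\<lambda>t. ennreal (logistic_density t)" "\<lambda>t. ennreal (logistic_density t)"]
    by (simp add: \<rho>_def ennreal_mult logistic_density_bounds nn_integral_logistic_density)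
  then have \<rho>1: "has_bochner_integral lborel \<rho> 1"
    using \<rho>b \<rho>m by (intro has_bochner_integral_nn_integral) auto
  let ?J = "\<lambda>n u v. LINT y|lborel. v y * (LINT x|lborel. u x * ((Suc n)^2 * \<rho> (Suc n *\<^sub>R (x - y))))"
  have lim: "(\<lambda>n. ?J n u v) \<longlonglongrightarrow> (LINT x|lborel. u x * v x)"
    if "u \<in> borel_measurable borel" "v \<in> borel_measurable borel" "\<And>x. \<bar>u x\<bar> \<le> K" "\<And>x. \<bar>v x\<bar> \<le> K"
      "\<And>x. x \<notin> cball c R \<Longrightarrow> u x = 0" "\<And>x. x \<notin> cball c R \<Longrightarrow> v x = 0" for u v
    using approximate_identity[OF that(1,2) \<rho>m that(3,5,4,6) \<rho>b] \<rho>1 by (simp add: has_bochner_integral_iff)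
  have J: "\<bar>?J n (\<lambda>x. A x \<bullet> e) (\<lambda>x. B x \<bullet> rot e) - ?J n (\<lambda>x. A x \<bullet> rot e) (\<lambda>x. B x \<bullet> e)\<bar> \<le> (C\<^sub>A + C\<^sub>B) * S" for n
  proof -
    define d where "d = real (Suc n)"
    have d: "0 < d" by (simp add: d_def)
    define f where "f t = logistic (d * t)" for t
    define g where "g t = d * logistic_density (d * t)" for t
    define f' where "f' t = - (d * logistic_density (d * t))" for t
    have [measurable]: "f \<in> borel_measurable borel" "g \<in> borel_measurable borel"
      unfolding f_def g_def by measurable
    have sm: "smooth_real f" "smooth_real g"
    proof -
      show "smooth_real f" using smooth_real_poly_logistic[of "[:0, 1:]" d] by (simp add: f_def[abs_def])
      have "g = (\<lambda>t. poly [:0, d, - d:] (logistic (d * t)))"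
        by (auto simp: g_def logistic_density_def algebra_simps)
      then show "smooth_real g" by (simp only: smooth_real_poly_logistic)
    qed
    have Dl: "((\<lambda>t. logistic (d * t)) has_real_derivative f' t) (at t)" for t
    proof -
      have "((\<lambda>t. d * t) has_real_derivative d) (at t)" by (auto intro!: derivative_eq_intros)
      from DERIV_chain'[where g = logistic, OF this logistic_deriv] show ?thesis
        by (simp add: f'_def logistic_density_def mult.commute)
    qed
    define g' where "g' t = d * (f' t * (1 - 2 * logistic (d * t)))" for t
    have Dg: "(g has_real_derivative g' t) (at t)" for t
      unfolding g_def logistic_density_def
      by (rule derivative_eq_intros Dl refl)+ (simp add: g'_def algebra_simps)
    have m': "f' \<in> borel_measurable borel" "g' \<in> borel_measurable borel"
      unfolding f'_def g'_def by measurable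
    \<comment> \<open>One constant that dominates the profiles and their derivatives; it need not be uniform in \<open>d\<close>.\<close>
    have fb: "\<bar>f t\<bar> \<le> 1 + d + d * d" for t
    proof -
      have "\<bar>f t\<bar> \<le> 1" using logistic_bounds[of "d * t"] by (simp add: f_def)
      moreover have "1 \<le> 1 + d + d * d" using d by simp
      ultimately show ?thesis by linarith
    qed
    have gb0: "\<bar>g t\<bar> \<le> d" "\<bar>f' t\<bar> \<le> d" for t
      using logistic_density_bounds[of "d * t"] d by (simp_all add: g_def f'_def)
    have gb: "\<bar>g t\<bar> \<le> 1 + d + d * d" "\<bar>f' t\<bar> \<le> 1 + d + d * d" for t
      using gb0[of t] d by (auto intro: order_trans simp: add_increasing)
    have gb': "\<bar>g' t\<bar> \<le> 1 + d + d * d" for t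
    proof -
      have "\<bar>1 - 2 * logistic (d * t)\<bar> \<le> 1" using logistic_bounds[of "d * t"] by auto
      then have "\<bar>f' t\<bar> * \<bar>1 - 2 * logistic (d * t)\<bar> \<le> d * 1"
        using gb0(2)[of t] d by (intro mult_mono) auto
      then have "\<bar>g' t\<bar> \<le> d * d"
        using d by (simp add: g'_def abs_mult mult_left_mono)
      then show ?thesis using d by simp
    qed
    have k: "f' (w \<bullet> e) * g (w \<bullet> rot e) = - (d^2 * \<rho> (d *\<^sub>R w))" for w
      by (simp add: f'_def g_def \<rho>_def power2_eq_square)
    have "?J n (\<lambda>x. A x \<bullet> e) (\<lambda>x. B x \<bullet> rot e) - ?J n (\<lambda>x. A x \<bullet> rot e) (\<lambda>x. B x \<bullet> e)
      = - ((LINT y|lborel. (B y \<bullet> rot e) * (LINT x|lborel. (A x \<bullet> e) * (f' ((x - y) \<bullet> e) * g ((x - y) \<bullet> rot e))))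
       - (LINT y|lborel. (B y \<bullet> e) * (LINT x|lborel. (A x \<bullet> rot e) * (f' ((x - y) \<bullet> e) * g ((x - y) \<bullet> rot e)))))"
      unfolding k by (simp add: d_def del: of_nat_Suc)
    also have "\<dots> = \<Lambda>\<^sub>A (\<lambda>x. LINT y|lborel. (B y \<bullet> rot e) * (f ((x - y) \<bullet> e) * g ((x - y) \<bullet> rot e)))
       + \<Lambda>\<^sub>B (\<lambda>y. LINT x|lborel. (A x \<bullet> rot e) * (f ((x - y) \<bullet> e) * g ((x - y) \<bullet> rot e)))"
      by (subst wedge_kernel_identity[OF int(1)[OF e] int(1)[OF ne] int(2)[OF e] int(2)[OF ne] \<Lambda> div sm
            Dl[folded f_def] Dg m' fb gb(2,1) gb']) simp_all
    finally have eq: "?J n (\<lambda>x. A x \<bullet> e) (\<lambda>x. B x \<bullet> rot e) - ?J n (\<lambda>x. A x \<bullet> rot e) (\<lambda>x. B x \<bullet> e) = \<dots>" .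
    have "\<bar>\<Lambda>\<^sub>A (\<lambda>x. LINT y|lborel. (B y \<bullet> rot e) * (f ((x - y) \<bullet> e) * g ((x - y) \<bullet> rot e)))\<bar> \<le> C\<^sub>A * S"
      by (rule charge_bound[OF \<Lambda>(1)]) (measurable, use S(1)[OF d] in \<open>simp add: f_def g_def\<close>)
    moreover have "\<bar>\<Lambda>\<^sub>B (\<lambda>y. LINT x|lborel. (A x \<bullet> rot e) * (f ((x - y) \<bullet> e) * g ((x - y) \<bullet> rot e)))\<bar> \<le> C\<^sub>B * S"
      by (rule charge_bound[OF \<Lambda>(2)]) (measurable, use S(2)[OF d] in \<open>simp add: f_def g_def\<close>)
    ultimately show ?thesis unfolding eq by (simp add: distrib_right abs_if split: if_splits)
  qed
  have prod: "integrable lborel (\<lambda>x. (A x \<bullet> v) * (B x \<bullet> w))" if "norm v = 1" "norm w = 1" for v w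
    by (rule integral_mult_bound(1)[OF int(1)[OF that(1)] _ comp(2)[OF that(2)]]) measurable
  have "(\<lambda>n. ?J n (\<lambda>x. A x \<bullet> e) (\<lambda>x. B x \<bullet> rot e) - ?J n (\<lambda>x. A x \<bullet> rot e) (\<lambda>x. B x \<bullet> e))
     \<longlonglongrightarrow> (LINT x|lborel. (A x \<bullet> e) * (B x \<bullet> rot e)) - (LINT x|lborel. (A x \<bullet> rot e) * (B x \<bullet> e))"
    by (intro tendsto_diff lim comp e ne suppc) auto
  then have "(\<lambda>n. ?J n (\<lambda>x. A x \<bullet> e) (\<lambda>x. B x \<bullet> rot e) - ?J n (\<lambda>x. A x \<bullet> rot e) (\<lambda>x. B x \<bullet> e))
     \<longlonglongrightarrow> (LINT x|lborel. (A x \<bullet> e) * (B x \<bullet> rot e) - (A x \<bullet> rot e) * (B x \<bullet> e))"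
    using prod e ne by simp
  then show ?thesis
    by (rule tendsto_upperbound[OF tendsto_rabs]) (use J in auto)
qed

section \<open>Divergences of localised differences\<close>

lemma charge_mono:
  assumes "charge \<Lambda> C" "C \<le> C'"
  shows "charge \<Lambda> C'"
  unfolding charge_def
proof (intro conjI allI impI)
  show "0 \<le> C'" using assms by (simp add: charge_def)
  fix \<phi> :: "real^2 \<Rightarrow> real" and c
  assume h: "\<phi> \<in> borel_measurable borel" "\<forall>x. \<bar>\<phi> x\<bar> \<le> c"
  have "0 \<le> c" using h(2)[rule_format, of 0] by linarith
  then show "\<bar>\<Lambda> \<phi>\<bar> \<le> C' * c"
    using charge_bound[OF assms(1) h(1), of c] h(2) mult_right_mono[OF assms(2), of c] by auto
qed (use charge_Fubini[OF assms(1)] in blast)+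

lemma lborel_shift:
  fixes f :: "real^2 \<Rightarrow> real"
  assumes [measurable]: "f \<in> borel_measurable borel"
  shows "(LINT x|lborel. f (x + z)) = (LINT x|lborel. f x)"
    and "integrable lborel (\<lambda>x. f (x + z)) \<longleftrightarrow> integrable lborel f"
proof -
  show "(LINT x|lborel. f (x + z)) = (LINT x|lborel. f x)"
    using integral_distr[of "(+) z" lborel borel f] by (simp add: lborel_distr_plus add.commute)
  show "integrable lborel (\<lambda>x. f (x + z)) \<longleftrightarrow> integrable lborel f"
    using integrable_distr_eq[of "(+) z" lborel borel f] by (simp add: lborel_distr_plus add.commute)
qed

lemma grad_translate:
  assumes "smooth f"
  shows "grad (\<lambda>x. f (x + v)) x = grad f (x + v)"
proof (rule grad_eqI)
  have 1: "((\<lambda>x. x + v) has_derivative (\<lambda>h. h)) (at x)" by (auto intro!: derivative_eq_intros)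
  have 2: "(f has_derivative (\<lambda>h. grad f (x + v) \<bullet> h)) (at (x + v))"
    by (rule has_derivative_grad[OF smooth_differentiable[OF assms]])
  from has_derivative_compose[OF 1 2]
  show "((\<lambda>x. f (x + v)) has_derivative (\<bullet>) (grad f (x + v))) (at x)" .
qed

lemma grad_mult:
  assumes "smooth f" "smooth g"
  shows "grad (\<lambda>x. f x * g x) x = f x *\<^sub>R grad g x + g x *\<^sub>R grad f x"
  using partial_deriv_mult[OF smooth_differentiable[OF assms(1)] smooth_differentiable[OF assms(2)]]
  by (simp add: grad_def vec_eq_iff)

lemma grad_measurable [measurable]:
  "smooth f \<Longrightarrow> grad f \<in> borel_measurable borel"
  by (rule borel_measurable_continuous_onI[OF smooth_grad_continuous])

lemma smooth_measurable: "smooth f \<Longrightarrow> f \<in> borel_measurable borel"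
  by (rule borel_measurable_continuous_onI[OF smooth_continuous])

lemma grad_outside_support:
  assumes "smooth f" "\<And>x. x \<notin> cball c R \<Longrightarrow> f x = 0" "x \<notin> cball c R"
  shows "grad f x = 0"
proof (rule grad_eqI)
  have "((\<lambda>_. 0) has_derivative (\<lambda>h. 0)) (at x)" by simp
  moreover have "open (- cball c R)" "x \<in> - cball c R" using assms(3) by auto
  ultimately have "(f has_derivative (\<lambda>h. 0)) (at x)"
    by (rule has_derivative_transform_within_open) (use assms(2) in auto)
  then show "(f has_derivative (\<bullet>) 0) (at x)" by (simp add: inner_zero_left[abs_def])
qed

lemma grad_bounded:
  assumes "smooth f" "\<And>x. x \<notin> cball c R \<Longrightarrow> f x = 0"
  obtains L where "0 \<le> L" "\<And>x. norm (grad f x) \<le> L"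
proof -
  have "compact (grad f ` cball c R)"
    using smooth_grad_continuous[OF assms(1)] by (intro compact_continuous_image) (auto intro: continuous_on_subset)
  then obtain L where "\<forall>y\<in>grad f ` cball c R. norm y \<le> L"
    using compact_imp_bounded bounded_iff by blast
  then have "norm (grad f x) \<le> max L 0" for x
    using grad_outside_support[OF assms] by (cases "x \<in> cball c R") (auto simp del: mem_cball intro: max.coboundedI1)
  then show thesis using that[of "max L 0"] by auto
qed

lemma lipschitz_of_grad_bound:
  assumes "smooth f" "\<And>x. norm (grad f x) \<le> L"
  shows "\<bar>f x - f y\<bar> \<le> L * dist x y"
proof -
  have "norm (f x - f y) \<le> L * norm (x - y)"
  proof (rule differentiable_bound[OF convex_UNIV])
    show "(f has_derivative (\<lambda>h. grad f x \<bullet> h)) (at x within UNIV)" for x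
      using has_derivative_grad[OF smooth_differentiable[OF assms(1)]] by simp
    show "onorm (\<lambda>h. grad f x \<bullet> h) \<le> L" for x
    proof (rule onorm_le)
      fix h
      show "norm (grad f x \<bullet> h) \<le> L * norm h"
        using Cauchy_Schwarz_ineq2[of "grad f x" h] mult_right_mono[OF assms(2) norm_ge_zero[of h], of x] by simp
    qed
  qed auto
  then show ?thesis by (simp add: dist_norm)
qed

definition bump :: "real^2 \<Rightarrow> real \<Rightarrow> real^2 \<Rightarrow> real" where
  "bump c R x = flat_exp (R\<^sup>2 - (dist c x)\<^sup>2)"

lemma bump_smooth: "smooth (bump c R)"
proof -
  have eq: "bump c R = (\<lambda>x. flat_exp (R\<^sup>2 + - 1 * ((x \<bullet> axis 1 1 + - (c $ 1)) * (x \<bullet> axis 1 1 + - (c $ 1))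
      + (x \<bullet> axis 2 1 + - (c $ 2)) * (x \<bullet> axis 2 1 + - (c $ 2)))))"
    by (simp add: fun_eq_iff bump_def dist_norm norm_minus_commute[of c] power2_norm_eq_inner inner_vec2 axis_def)
      (simp add: algebra_simps)
  have "Ck k (\<lambda>x. R\<^sup>2 + - 1 * ((x \<bullet> axis 1 1 + - (c $ 1)) * (x \<bullet> axis 1 1 + - (c $ 1))
      + (x \<bullet> axis 2 1 + - (c $ 2)) * (x \<bullet> axis 2 1 + - (c $ 2))))" for k
    by (rule Ck_add[OF Ck_const Ck_mult[OF Ck_const Ck_add[OF Ck_mult[OF Ck_add[OF Ck_inner Ck_const]
       Ck_add[OF Ck_inner Ck_const]] Ck_mult[OF Ck_add[OF Ck_inner Ck_const] Ck_add[OF Ck_inner Ck_const]]]]])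
  then show ?thesis unfolding eq by (intro smooth_compose[OF flat_exp_smooth]) blast
qed

lemma bump_nonneg: "0 \<le> bump c R x" by (simp add: bump_def flat_exp_def)

lemma bump_le_1: "bump c R x \<le> 1" by (simp add: bump_def flat_exp_def)

lemma bump_outside: "0 \<le> R \<Longrightarrow> x \<notin> cball c R \<Longrightarrow> bump c R x = 0"
  using power_mono[of R "dist c x" 2] by (auto simp: bump_def flat_exp_def not_less)

lemma bump_lower:
  assumes "x \<in> ball c r" "0 < r"
  shows "flat_exp (3 * r\<^sup>2) \<le> bump c (2 * r) x" "0 < flat_exp (3 * r\<^sup>2)"
proof -
  have "(dist c x)\<^sup>2 \<le> r\<^sup>2" using assms by (intro power_mono) auto
  then have le: "3 * r\<^sup>2 \<le> (2 * r)\<^sup>2 - (dist c x)\<^sup>2" by (simp add: power_mult_distrib)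
  have p: "0 < 3 * r\<^sup>2" using assms by simp
  then show "0 < flat_exp (3 * r\<^sup>2)" by (simp add: flat_exp_def)
  have "1 / ((2 * r)\<^sup>2 - (dist c x)\<^sup>2) \<le> 1 / (3 * r\<^sup>2)"
    using le p less_le_trans[OF p le] by (intro divide_left_mono mult_pos_pos) auto
  then show "flat_exp (3 * r\<^sup>2) \<le> bump c (2 * r) x"
    using less_le_trans[OF p le] p by (simp add: bump_def flat_exp_def)
qed

text \<open>Restricting the measure to the compact set $K$ makes it finite, and the integrals of functions that
vanish outside $K$ do not change.\<close>
lemma positive_radon_charge:
  assumes \<mu>: "positive_radon \<Omega> \<mu>" and K: "compact K" "K \<subseteq> \<Omega>"
  obtains \<Lambda> C where "charge \<Lambda> C"
    "\<And>\<phi>. \<phi> \<in> borel_measurable borel \<Longrightarrow> (\<And>x. x \<notin> K \<Longrightarrow> \<phi> x = 0) \<Longrightarrow> (LINT x|\<mu>. \<phi> x) = \<Lambda> \<phi>"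
proof -
  have s: "sets \<mu> = sets (restrict_space borel \<Omega>)" using \<mu> by (simp add: positive_radon_def)
  then have sp: "space \<mu> = \<Omega>" using sets_eq_imp_space_eq[OF s] by (simp add: space_restrict_space)
  have Kb: "K \<in> sets borel" using K by (simp add: borel_compact)
  then have Ks: "K \<inter> space \<mu> \<in> sets \<mu>" using K
    by (auto simp: s sp sets_restrict_space image_iff intro!: bexI[of _ K])
  have id: "(\<lambda>x. x) \<in> measurable (restrict_space \<mu> K) borel"
    by (rule measurable_restrict_space1) (simp add: measurable_cong_sets[OF s refl] measurable_restrict_space1)
  define N where "N = distr (restrict_space \<mu> K) borel (\<lambda>x. x)"
  have "emeasure N (space N) < \<infinity>"
  proof -
    have "emeasure N (space N) = emeasure (restrict_space \<mu> K) (space (restrict_space \<mu> K))"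
      unfolding N_def by (subst emeasure_distr[OF id]) auto
    also have "\<dots> = emeasure \<mu> K"
      using Ks K by (subst emeasure_restrict_space) (auto simp: space_restrict_space sp Int_absorb2)
    also have "\<dots> < \<infinity>" using \<mu> K by (simp add: positive_radon_def)
    finally show ?thesis .
  qed
  then have "finite_measure N" by (intro finite_measureI) auto
  moreover have "sets N = sets borel" by (simp add: N_def)
  ultimately have ch: "charge (\<lambda>\<phi>. LINT x|N. \<phi> x) (measure N (space N))" by (rule charge_finite_measure)
  show thesis
  proof (rule that[OF ch])
    fix \<phi> :: "real^2 \<Rightarrow> real"
    assume m: "\<phi> \<in> borel_measurable borel" and z: "\<And>x. x \<notin> K \<Longrightarrow> \<phi> x = 0"
    have "(LINT x|N. \<phi> x) = (LINT x|restrict_space \<mu> K. \<phi> x)"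
      unfolding N_def by (rule integral_distr[OF id m])
    also have "\<dots> = (LINT x|\<mu>. indicator K x *\<^sub>R \<phi> x)"
      by (rule integral_restrict_space[OF Ks])
    also have "\<dots> = (LINT x|\<mu>. \<phi> x)"
      by (rule Bochner_Integration.integral_cong) (use z in \<open>auto simp: indicator_def\<close>)
    finally show "(LINT x|\<mu>. \<phi> x) = (LINT x|N. \<phi> x)" by simp
  qed
qed

text \<open>This passes from the distributional divergence of $F$ on $\Omega$ to a functional on functions on
the plane that are supported in a ball, and from $F$ to a Borel representative $F'$ that is defined
on the whole plane.\<close>
lemma divergence_charge:
  fixes F F' :: "real^2 \<Rightarrow> real^2"
  assumes op: "open \<Omega>" and M: "distr_div \<Omega> F \<in> M_loc \<Omega>"
    and Fm: "F \<in> borel_measurable (lebesgue_on \<Omega>)"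
    and F'm[measurable]: "F' \<in> borel_measurable borel" and FF': "AE x in lborel. x \<in> \<Omega> \<longrightarrow> F x = F' x"
    and ball: "cball c R \<subseteq> \<Omega>"
  obtains \<Lambda> C where "charge \<Lambda> C"
    "\<And>\<phi>. smooth \<phi> \<Longrightarrow> (\<And>x. x \<notin> cball c R \<Longrightarrow> \<phi> x = 0) \<Longrightarrow> (LINT x|lborel. F' x \<bullet> grad \<phi> x) = - \<Lambda> \<phi>"
proof -
  obtain \<mu> \<nu> where \<mu>: "positive_radon \<Omega> \<mu>" and \<nu>: "positive_radon \<Omega> \<nu>"
    and T: "\<And>\<phi>. \<phi> \<in> test_functions \<Omega> \<Longrightarrow> distr_div \<Omega> F \<phi> = (LINT x|\<mu>. \<phi> x) - (LINT x|\<nu>. \<phi> x)"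
    using M by (auto simp: M_loc_def)
  obtain \<Lambda>1 C1 where 1: "charge \<Lambda>1 C1"
    "\<And>\<phi>. \<phi> \<in> borel_measurable borel \<Longrightarrow> (\<And>x. x \<notin> cball c R \<Longrightarrow> \<phi> x = 0) \<Longrightarrow> (LINT x|\<mu>. \<phi> x) = \<Lambda>1 \<phi>"
    by (rule positive_radon_charge[OF \<mu> compact_cball ball]) blast
  obtain \<Lambda>2 C2 where 2: "charge \<Lambda>2 C2"
    "\<And>\<phi>. \<phi> \<in> borel_measurable borel \<Longrightarrow> (\<And>x. x \<notin> cball c R \<Longrightarrow> \<phi> x = 0) \<Longrightarrow> (LINT x|\<nu>. \<phi> x) = \<Lambda>2 \<phi>"
    by (rule positive_radon_charge[OF \<nu> compact_cball ball]) blast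
  show thesis
  proof (rule that[OF charge_diff[OF 1(1) 2(1)]])
    fix \<phi> :: "real^2 \<Rightarrow> real"
    assume sm: "smooth \<phi>" and z: "\<And>x. x \<notin> cball c R \<Longrightarrow> \<phi> x = 0"
    have sub: "closure {x. \<phi> x \<noteq> 0} \<subseteq> cball c R" by (rule closure_minimal) (use z in blast, simp)
    then have "compact (closure {x. \<phi> x \<noteq> 0})"
      by (meson bounded_cball bounded_subset closed_closure compact_eq_bounded_closed)
    then have "\<phi> \<in> test_functions \<Omega>" using sm sub ball by (auto simp: test_functions_def)
    note T[OF this]
    moreover have "(LINT x|lebesgue_on \<Omega>. F x \<bullet> grad \<phi> x) = (LINT x|lborel. F' x \<bullet> grad \<phi> x)"
    proof -
      have gm[measurable]: "grad \<phi> \<in> borel_measurable borel" by (rule grad_measurable[OF sm])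
      have "(LINT x|lebesgue_on \<Omega>. F x \<bullet> grad \<phi> x) = (LINT x|lebesgue. indicator \<Omega> x *\<^sub>R (F x \<bullet> grad \<phi> x))"
        using op by (intro integral_restrict_space) auto
      also have "\<dots> = (LINT x|lebesgue. F' x \<bullet> grad \<phi> x)"
      proof (rule integral_cong_AE)
        have "(\<lambda>x. F x \<bullet> grad \<phi> x) \<in> borel_measurable (lebesgue_on \<Omega>)"
          using gm by (intro borel_measurable_inner[OF Fm] measurable_restrict_space1 measurable_completion) simp
        then show "(\<lambda>x. indicator \<Omega> x *\<^sub>R (F x \<bullet> grad \<phi> x)) \<in> borel_measurable lebesgue"
          using op by (subst (asm) borel_measurable_restrict_space_iff) (auto simp: mult.commute)
        show "(\<lambda>x. F' x \<bullet> grad \<phi> x) \<in> borel_measurable lebesgue"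
          by (rule measurable_completion) measurable
        show "AE x in lebesgue. indicator \<Omega> x *\<^sub>R (F x \<bullet> grad \<phi> x) = F' x \<bullet> grad \<phi> x"
          using AE_completion[OF FF']
        proof eventually_elim
          case (elim x)
          show ?case
          proof (cases "x \<in> \<Omega>")
            case False
            then have "x \<notin> cball c R" using ball by blast
            from grad_outside_support[OF sm z this] show ?thesis using False by simp
          qed (use elim in simp)
        qed
      qed
      also have "\<dots> = (LINT x|lborel. F' x \<bullet> grad \<phi> x)" by (rule integral_completion) measurable
      finally show ?thesis .
    qed
    ultimately show "(LINT x|lborel. F' x \<bullet> grad \<phi> x) = - (\<Lambda>1 \<phi> - \<Lambda>2 \<phi>)"
      using 1(2) 2(2) smooth_measurable[OF sm] z by (simp add: distr_div_def)
  qed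
qed

text \<open>The divergence of $\eta\, DF$ consists of $\eta$ times the difference of the divergence of $F$ and
its translate, and of the density $DF \cdot \nabla \eta$. Both masses are bounded independently of $z$. The cutoff
lives on the ball of radius $2r$ and the divergence of $F$ is controlled on the ball of radius $3r$,
which leaves room for translations of length at most $r$.\<close>
lemma localized_difference_charge:
  fixes F :: "real^2 \<Rightarrow> real^2"
  assumes F[measurable]: "F \<in> borel_measurable borel" and FK: "\<And>x. norm (F x) \<le> K"
    and \<Lambda>: "charge \<Lambda> C"
    and div: "\<And>\<phi>. smooth \<phi> \<Longrightarrow> (\<And>x. x \<notin> cball c (3 * r) \<Longrightarrow> \<phi> x = 0) \<Longrightarrow> (LINT x|lborel. F x \<bullet> grad \<phi> x) = - \<Lambda> \<phi>"
    and r: "0 < r"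
  obtains C' where "\<forall>z. norm z \<le> r \<longrightarrow> (\<exists>\<Lambda>'. charge \<Lambda>' C' \<and>
     (\<forall>\<psi>. smooth \<psi> \<longrightarrow> (LINT x|lborel. (bump c (2 * r) x *\<^sub>R (F (x + z) - F x)) \<bullet> grad \<psi> x) = - \<Lambda>' \<psi>))"
proof -
  let ?\<eta> = "bump c (2 * r)"
  have K0: "0 \<le> K" using FK[of 0] norm_ge_zero[of "F 0"] by linarith
  have sm: "smooth ?\<eta>" by (rule bump_smooth)
  have out: "x \<notin> cball c (2 * r) \<Longrightarrow> ?\<eta> x = 0" for x using bump_outside r by auto
  have [measurable]: "?\<eta> \<in> borel_measurable borel" "grad ?\<eta> \<in> borel_measurable borel"
    by (rule smooth_measurable[OF sm], rule grad_measurable[OF sm])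
  obtain L where L: "0 \<le> L" "\<And>x. norm (grad ?\<eta> x) \<le> L" using grad_bounded[OF sm out] by blast
  define I where "I = (LINT x|lborel. norm (grad ?\<eta> x))"
  have Ii: "integrable lborel (\<lambda>x. norm (grad ?\<eta> x))"
    by (rule integrable_bounded_support[of _ L c "2 * r"]) (use L grad_outside_support[OF sm out] in auto)
  show thesis
  proof (rule that[of "(C + C) * 1 + 2 * K * I"], intro allI impI)
    fix z :: "real^2" assume z: "norm z \<le> r"
    define D where "D x = F (x + z) - F x" for x
    have [measurable]: "D \<in> borel_measurable borel" unfolding D_def by measurable
    have DK: "norm (D x) \<le> 2 * K" for x
      using norm_triangle_ineq4[of "F (x + z)" "F x"] FK[of x] FK[of "x + z"] by (simp add: D_def)
    have inner_bound: "\<bar>u \<bullet> grad \<phi> x\<bar> \<le> B * L'" if "norm u \<le> B" "norm (grad \<phi> x) \<le> L'" "0 \<le> B"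
      for u \<phi> x B L'
      using Cauchy_Schwarz_ineq2[of u "grad \<phi> x"] mult_mono[OF that(1,2,3) norm_ge_zero] by linarith
    have int: "integrable lborel (\<lambda>x. u x \<bullet> grad \<phi> x)"
      if s: "smooth \<phi>" and o: "\<And>x. x \<notin> cball b \<rho> \<Longrightarrow> \<phi> x = 0"
        and [measurable]: "u \<in> borel_measurable borel" and B: "\<And>x. norm (u x) \<le> B" "0 \<le> B" for u \<phi> b \<rho> B
    proof -
      obtain L' where L': "\<And>x. norm (grad \<phi> x) \<le> L'" using grad_bounded[OF s o] by blast
      have [measurable]: "grad \<phi> \<in> borel_measurable borel" by (rule grad_measurable[OF s])
      show ?thesis
        by (rule integrable_bounded_support[of _ "B * L'" b \<rho>])
          (use inner_bound[OF B(1) L' B(2)] grad_outside_support[OF s o] in auto)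
    qed
    have diffdiv: "(LINT x|lborel. D x \<bullet> grad \<phi> x) = - (\<Lambda> (\<lambda>x. \<phi> (x + - z)) - \<Lambda> \<phi>)"
      if s: "smooth \<phi>" and o: "\<And>x. x \<notin> cball c (2 * r) \<Longrightarrow> \<phi> x = 0" for \<phi>
    proof -
      have [measurable]: "grad \<phi> \<in> borel_measurable borel" by (rule grad_measurable[OF s])
      have o3: "\<phi> x = 0" if "x \<notin> cball c (3 * r)" for x using that o[of x] r by auto
      have s': "smooth (\<lambda>x. \<phi> (x + - z))" using s by (simp add: Ck_translate del: add_uminus_conv_diff)
      have o3': "\<phi> (x + - z) = 0" if "x \<notin> cball c (3 * r)" for x
      proof (rule o)
        have "dist c x \<le> dist c (x + - z) + dist (x + - z) x" by (rule dist_triangle)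
        then show "x + - z \<notin> cball c (2 * r)" using that z by (auto simp: dist_norm)
      qed
      have "(LINT x|lborel. F (x + z) \<bullet> grad \<phi> x) = (LINT x|lborel. F (x + z) \<bullet> grad \<phi> (x + z + - z))" by simp
      also have "\<dots> = (LINT x|lborel. F x \<bullet> grad \<phi> (x + - z))"
        by (rule lborel_shift(1)[of "\<lambda>x. F x \<bullet> grad \<phi> (x + - z)"]) measurable
      also have "\<dots> = - \<Lambda> (\<lambda>x. \<phi> (x + - z))"
        using div[OF s' o3'] grad_translate[OF s, of "- z"] by simp
      finally have 1: "(LINT x|lborel. F (x + z) \<bullet> grad \<phi> x) = - \<Lambda> (\<lambda>x. \<phi> (x + - z))" .
      have 2: "integrable lborel (\<lambda>x. F (x + z) \<bullet> grad \<phi> x)" "integrable lborel (\<lambda>x. F x \<bullet> grad \<phi> x)"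
        by (rule int[OF s o _ FK K0], auto)+
      show ?thesis
        using 1 2 div[OF s o3] by (simp add: D_def inner_diff_left)
    qed
    have c1: "charge (\<lambda>\<phi>. \<Lambda> (\<lambda>x. \<phi> (x + - z)) - \<Lambda> \<phi>) (C + C)"
      by (rule charge_diff[OF charge_translate[OF \<Lambda>] \<Lambda>])
    have c2: "charge (\<lambda>\<psi>. \<Lambda> (\<lambda>x. ?\<eta> (x + - z) * \<psi> (x + - z)) - \<Lambda> (\<lambda>x. ?\<eta> x * \<psi> x)) ((C + C) * 1)"
      using charge_weight[OF c1, of ?\<eta> 1] bump_nonneg bump_le_1 by simp
    have gi: "integrable lborel (\<lambda>x. - D x \<bullet> grad ?\<eta> x)"
      by (rule int[where B = "2 * K", OF sm out]) (use DK K0 in auto)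
    have "(LINT x|lborel. \<bar>- D x \<bullet> grad ?\<eta> x\<bar>) \<le> (LINT x|lborel. 2 * K * norm (grad ?\<eta> x))"
    proof (rule integral_mono)
      show "\<bar>- D x \<bullet> grad ?\<eta> x\<bar> \<le> 2 * K * norm (grad ?\<eta> x)" for x
        using inner_bound[of "- D x" "2 * K" ?\<eta> x "norm (grad ?\<eta> x)"] DK K0 by simp
    qed (use gi Ii in auto)
    then have mass: "(LINT x|lborel. \<bar>- D x \<bullet> grad ?\<eta> x\<bar>) \<le> 2 * K * I" by (simp add: I_def)
    let ?\<Lambda>' = "\<lambda>\<psi>. (\<Lambda> (\<lambda>x. ?\<eta> (x + - z) * \<psi> (x + - z)) - \<Lambda> (\<lambda>x. ?\<eta> x * \<psi> x))
        - (LINT x|lborel. (- D x \<bullet> grad ?\<eta> x) * \<psi> x)"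
    show "\<exists>\<Lambda>'. charge \<Lambda>' ((C + C) * 1 + 2 * K * I) \<and>
     (\<forall>\<psi>. smooth \<psi> \<longrightarrow> (LINT x|lborel. (?\<eta> x *\<^sub>R (F (x + z) - F x)) \<bullet> grad \<psi> x) = - \<Lambda>' \<psi>)"
    proof (intro exI[of _ ?\<Lambda>'] conjI allI impI)
      show "charge ?\<Lambda>' ((C + C) * 1 + 2 * K * I)"
        by (rule charge_mono[OF charge_diff[OF c2 charge_density[OF gi]]]) (use mass in simp)
      fix \<psi> assume s: "smooth \<psi>"
      have [measurable]: "\<psi> \<in> borel_measurable borel" "grad \<psi> \<in> borel_measurable borel"
        by (rule smooth_measurable[OF s], rule grad_measurable[OF s])
      have sp: "smooth (\<lambda>x. ?\<eta> x * \<psi> x)" by (rule smooth_mult[OF sm s])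
      have op: "?\<eta> x * \<psi> x = 0" if "x \<notin> cball c (2 * r)" for x using out[OF that] by simp
      have i1: "integrable lborel (\<lambda>x. D x \<bullet> grad (\<lambda>x. ?\<eta> x * \<psi> x) x)"
        by (rule int[OF sp op _ DK]) (use K0 in auto)
      have "compact (\<psi> ` cball c (2 * r))"
        using smooth_continuous[OF s] by (intro compact_continuous_image) (auto intro: continuous_on_subset)
      then obtain B where B: "\<And>x. x \<in> cball c (2 * r) \<Longrightarrow> \<bar>\<psi> x\<bar> \<le> B"
        using compact_imp_bounded bounded_iff by (metis imageI real_norm_def)
      have i2: "integrable lborel (\<lambda>x. (- D x \<bullet> grad ?\<eta> x) * \<psi> x)"
      proof (rule integrable_bounded_support[of _ "2 * K * L * \<bar>B\<bar>" c "2 * r"])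
        show 0: "(- D x \<bullet> grad ?\<eta> x) * \<psi> x = 0" if "x \<notin> cball c (2 * r)" for x
          using grad_outside_support[OF sm out that] by simp
        show "\<bar>(- D x \<bullet> grad ?\<eta> x) * \<psi> x\<bar> \<le> 2 * K * L * \<bar>B\<bar>" for x
        proof (cases "x \<in> cball c (2 * r)")
          case True
          have "\<bar>- D x \<bullet> grad ?\<eta> x\<bar> \<le> 2 * K * L"
            using inner_bound[of "- D x" "2 * K" ?\<eta> x L] DK K0 L by simp
          moreover have "\<bar>\<psi> x\<bar> \<le> \<bar>B\<bar>" using B[OF True] by linarith
          ultimately show ?thesis unfolding abs_mult using K0 L by (intro mult_mono) auto
        next
          case False
          show ?thesis unfolding 0[OF False] using K0 L by simp
        qed
      qed measurable
      have "(?\<eta> x *\<^sub>R D x) \<bullet> grad \<psi> x = D x \<bullet> grad (\<lambda>x. ?\<eta> x * \<psi> x) x + (- D x \<bullet> grad ?\<eta> x) * \<psi> x" for x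
        by (simp add: grad_mult[OF sm s] inner_add_right)
      then have "(LINT x|lborel. (?\<eta> x *\<^sub>R D x) \<bullet> grad \<psi> x)
          = (LINT x|lborel. D x \<bullet> grad (\<lambda>x. ?\<eta> x * \<psi> x) x) + (LINT x|lborel. (- D x \<bullet> grad ?\<eta> x) * \<psi> x)"
        using i1 i2 by (simp only: Bochner_Integration.integral_add)
      then show "(LINT x|lborel. (?\<eta> x *\<^sub>R (F (x + z) - F x)) \<bullet> grad \<psi> x) = - ?\<Lambda>' \<psi>"
        using diffdiv[OF sp op] by (simp add: D_def)
    qed
  qed
qed

lemma wedge_frame:
  fixes a b :: "real^2"
  assumes "norm e = 1"
  shows "(a \<bullet> e) * (b \<bullet> rot e) - (a \<bullet> rot e) * (b \<bullet> e) = a $ 1 * b $ 2 - a $ 2 * b $ 1"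
proof -
  have e: "e $ 1 * e $ 1 + e $ 2 * e $ 2 = 1"
    using assms by (simp add: norm_eq_sqrt_inner inner_vec2)
  have "(a \<bullet> e) * (b \<bullet> rot e) - (a \<bullet> rot e) * (b \<bullet> e)
      = (a $ 1 * b $ 2 - a $ 2 * b $ 1) * (e $ 1 * e $ 1 + e $ 2 * e $ 2)"
    by (simp add: inner_vec2 rot_def algebra_simps)
  then show ?thesis by (simp add: e)
qed

text \<open>Combines the interaction identity with the oscillation bound in the frame whose first vector is
$z / |z|$. The two antiderivatives run in opposite directions, so the step profile decreases for
one field and increases for the other.\<close>
lemma wedge_difference_bound:
  fixes F G :: "real^2 \<Rightarrow> real^2"
  assumes F[measurable]: "F \<in> borel_measurable borel" and FK: "\<And>x. norm (F x) \<le> K"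
    and G[measurable]: "G \<in> borel_measurable borel" and GK: "\<And>x. norm (G x) \<le> K"
    and \<Lambda>: "charge \<Lambda>\<^sub>F C\<^sub>F" "charge \<Lambda>\<^sub>G C\<^sub>G"
    and divF: "\<And>\<phi>. smooth \<phi> \<Longrightarrow> (\<And>x. x \<notin> cball c (3 * r) \<Longrightarrow> \<phi> x = 0) \<Longrightarrow> (LINT x|lborel. F x \<bullet> grad \<phi> x) = - \<Lambda>\<^sub>F \<phi>"
    and divG: "\<And>\<phi>. smooth \<phi> \<Longrightarrow> (\<And>x. x \<notin> cball c (3 * r) \<Longrightarrow> \<phi> x = 0) \<Longrightarrow> (LINT x|lborel. G x \<bullet> grad \<phi> x) = - \<Lambda>\<^sub>G \<phi>"
    and r: "0 < r"
  obtains C where "0 \<le> C" "\<And>z. norm z \<le> r \<Longrightarrow> norm z \<le> 1 \<Longrightarrow>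
     (LINT x|lborel. (bump c (2 * r) x)\<^sup>2 * ((F (x + z) - F x) $ 1 * (G (x + z) - G x) $ 2
        - (F (x + z) - F x) $ 2 * (G (x + z) - G x) $ 1)) \<le> C * norm z"
proof -
  let ?\<eta> = "bump c (2 * r)"
  have K0: "0 \<le> K" using FK[of 0] norm_ge_zero[of "F 0"] by linarith
  have sm: "smooth ?\<eta>" by (rule bump_smooth)
  have out: "x \<notin> cball c (2 * r) \<Longrightarrow> ?\<eta> x = 0" for x using bump_outside r by auto
  have \<eta>m[measurable]: "?\<eta> \<in> borel_measurable borel" by (rule smooth_measurable[OF sm])
  have \<eta>1: "\<bar>?\<eta> x\<bar> \<le> 1" for x using bump_nonneg bump_le_1 by (simp add: abs_of_nonneg)
  obtain L where L: "0 \<le> L" "\<And>x. norm (grad ?\<eta> x) \<le> L" using grad_bounded[OF sm out] by blast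
  note lip = lipschitz_of_grad_bound[OF sm L(2)]
  obtain C1 where C1: "\<forall>z. norm z \<le> r \<longrightarrow> (\<exists>\<Lambda>'. charge \<Lambda>' C1 \<and>
     (\<forall>\<psi>. smooth \<psi> \<longrightarrow> (LINT x|lborel. (?\<eta> x *\<^sub>R (F (x + z) - F x)) \<bullet> grad \<psi> x) = - \<Lambda>' \<psi>))"
    by (rule localized_difference_charge[OF F FK \<Lambda>(1) divF r])
  obtain C2 where C2: "\<forall>z. norm z \<le> r \<longrightarrow> (\<exists>\<Lambda>'. charge \<Lambda>' C2 \<and>
     (\<forall>\<psi>. smooth \<psi> \<longrightarrow> (LINT x|lborel. (?\<eta> x *\<^sub>R (G (x + z) - G x)) \<bullet> grad \<psi> x) = - \<Lambda>' \<psi>))"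
    by (rule localized_difference_charge[OF G GK \<Lambda>(2) divG r])
  have "0 \<le> C1" "0 \<le> C2" using C1[rule_format, of 0] C2[rule_format, of 0] r by (auto simp: charge_def)
  define Q where "Q = K * (2 * L * (2 * r + 1) + 1)"
  have Q0: "0 \<le> Q" using K0 L r by (simp add: Q_def)
  show thesis
  proof (rule that[of "(C1 + C2) * Q"])
    show "0 \<le> (C1 + C2) * Q" using \<open>0 \<le> C1\<close> \<open>0 \<le> C2\<close> Q0 by simp
    fix z :: "real^2" assume z: "norm z \<le> r" "norm z \<le> 1"
    show "(LINT x|lborel. (?\<eta> x)\<^sup>2 * ((F (x + z) - F x) $ 1 * (G (x + z) - G x) $ 2
        - (F (x + z) - F x) $ 2 * (G (x + z) - G x) $ 1)) \<le> (C1 + C2) * Q * norm z"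
    proof (cases "z = 0")
      case False
      define h where "h = norm z"
      define e where "e = (1 / h) *\<^sub>R z"
      have h: "0 < h" "0 \<le> h" "h \<le> 1" using False z by (auto simp: h_def)
      have e: "norm e = 1" using h by (simp add: e_def h_def)
      have ze: "z = h *\<^sub>R e" using h by (simp add: e_def)
      have ne: "norm (rot e) = 1" using e by (simp add: norm_eq_sqrt_inner inner_vec2 rot_def add.commute)
      have comp: "\<bar>F x \<bullet> rot e\<bar> \<le> K" "\<bar>G x \<bullet> rot e\<bar> \<le> K" for x
        using Cauchy_Schwarz_ineq2[of "F x" "rot e"] Cauchy_Schwarz_ineq2[of "G x" "rot e"] FK[of x] GK[of x] ne by auto
      obtain \<Lambda>\<^sub>A where A: "charge \<Lambda>\<^sub>A C1"
        "\<And>\<psi>. smooth \<psi> \<Longrightarrow> (LINT x|lborel. (?\<eta> x *\<^sub>R (F (x + z) - F x)) \<bullet> grad \<psi> x) = - \<Lambda>\<^sub>A \<psi>"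
        using C1 z(1) by blast
      obtain \<Lambda>\<^sub>B where B: "charge \<Lambda>\<^sub>B C2"
        "\<And>\<psi>. smooth \<psi> \<Longrightarrow> (LINT x|lborel. (?\<eta> x *\<^sub>R (G (x + z) - G x)) \<bullet> grad \<psi> x) = - \<Lambda>\<^sub>B \<psi>"
        using C2 z(1) by blast
      have dens: "(\<integral>\<^sup>+t. ennreal (d * logistic_density (d * (t - a))) \<partial>lborel) = 1"
        "(\<integral>\<^sup>+t. ennreal (d * logistic_density (d * (a - t))) \<partial>lborel) = 1" if "0 < d" for d a
        using nn_integral_scaled_density[OF logistic_density_measurable nn_integral_logistic_density _ logistic_density_bounds(1), of d "- d * a"]
          nn_integral_scaled_density[OF logistic_density_measurable nn_integral_logistic_density _ logistic_density_bounds(1), of "- d" "d * a"] that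
        by (simp_all add: algebra_simps)
      have dm: "(\<lambda>t. d * logistic_density (d * (t - a))) \<in> borel_measurable borel"
        "(\<lambda>t. d * logistic_density (d * (a - t))) \<in> borel_measurable borel" for d a by measurable
      have db: "0 \<le> d * logistic_density s" "d * logistic_density s \<le> d" if "0 < d" for d s
        using that logistic_density_bounds[of s] by (auto intro: mult_left_le)
      have S1: "\<bar>LINT x|lborel. ((?\<eta> x *\<^sub>R (F (x + z) - F x)) \<bullet> rot e) *
          (logistic (d * ((x - y) \<bullet> e)) * (d * logistic_density (d * ((x - y) \<bullet> rot e))))\<bar> \<le> Q * h" if d: "0 < d" for d y
      proof -
        have D: "((\<lambda>t. logistic (d * (t - y \<bullet> e))) has_real_derivative - (d * logistic_density (d * (t - y \<bullet> e)))) (at t)" for t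
        proof -
          have "((\<lambda>t. d * (t - y \<bullet> e)) has_real_derivative d) (at t)" by (auto intro!: derivative_eq_intros)
          from DERIV_chain'[where g = logistic, OF this logistic_deriv] show ?thesis
            by (simp add: logistic_density_def mult.commute)
        qed
        have "\<bar>LINT x|lborel. ?\<eta> x * (F (x + h *\<^sub>R e) \<bullet> rot e - F x \<bullet> rot e) *
          (logistic (d * (x \<bullet> e - y \<bullet> e)) * (d * logistic_density (d * (x \<bullet> rot e - y \<bullet> rot e))))\<bar>
          \<le> K * (2 * L * (2 * r + 1) + 1) * h"
        proof (rule oscillation_along_direction[OF e h(2,3) _ \<eta>m _ dm(1) comp(1) \<eta>1 out lip _ _ _ _ db dens(1)[OF d]])
          show "(\<integral>\<^sup>+t. ennreal \<bar>logistic (d * (t - h - y \<bullet> e)) - logistic (d * (t - y \<bullet> e))\<bar> \<partial>lborel) \<le> ennreal h"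
            using nn_integral_shift_decreasing[OF D dm(1) db(1)[OF d] dens(1)[OF d] h(2)] by simp
        qed (use d r logistic_bounds in \<open>auto intro: less_imp_le\<close>)
        then show ?thesis
          by (simp add: ze inner_diff_left Q_def)
      qed
      have S2: "\<bar>LINT y|lborel. ((?\<eta> y *\<^sub>R (G (y + z) - G y)) \<bullet> rot e) *
          (logistic (d * ((x - y) \<bullet> e)) * (d * logistic_density (d * ((x - y) \<bullet> rot e))))\<bar> \<le> Q * h" if d: "0 < d" for d x
      proof -
        have D: "((\<lambda>t. - logistic (d * (x \<bullet> e - t))) has_real_derivative - (d * logistic_density (d * (x \<bullet> e - t)))) (at t)" for t
        proof -
          have "((\<lambda>t. d * (x \<bullet> e - t)) has_real_derivative - d) (at t)" by (auto intro!: derivative_eq_intros)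
          from DERIV_minus[OF DERIV_chain'[where g = logistic, OF this logistic_deriv]] show ?thesis
            by (simp add: logistic_density_def mult.commute)
        qed
        have "\<bar>LINT y|lborel. ?\<eta> y * (G (y + h *\<^sub>R e) \<bullet> rot e - G y \<bullet> rot e) *
          (logistic (d * (x \<bullet> e - y \<bullet> e)) * (d * logistic_density (d * (x \<bullet> rot e - y \<bullet> rot e))))\<bar>
          \<le> K * (2 * L * (2 * r + 1) + 1) * h"
        proof (rule oscillation_along_direction[OF e h(2,3) _ \<eta>m _ dm(2) comp(2) \<eta>1 out lip _ _ _ _ db dens(2)[OF d]])
          show "(\<integral>\<^sup>+t. ennreal \<bar>logistic (d * (x \<bullet> e - (t - h))) - logistic (d * (x \<bullet> e - t))\<bar> \<partial>lborel) \<le> ennreal h"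
            using nn_integral_shift_decreasing[OF D dm(2) db(1)[OF d] dens(2)[OF d] h(2)]
            by (simp add: abs_minus_commute)
        qed (use d r logistic_bounds in \<open>auto intro: less_imp_le\<close>)
        then show ?thesis
          by (simp add: ze inner_diff_left Q_def)
      qed
      have NF: "norm (?\<eta> x *\<^sub>R (F (x + z) - F x)) \<le> 2 * K" for x
        using mult_mono[OF \<eta>1 norm_triangle_ineq4[of "F (x + z)" "F x"], of x] FK[of x] FK[of "x + z"] by simp
      have NG: "norm (?\<eta> x *\<^sub>R (G (x + z) - G x)) \<le> 2 * K" for x
        using mult_mono[OF \<eta>1 norm_triangle_ineq4[of "G (x + z)" "G x"], of x] GK[of x] GK[of "x + z"] by simp
      have "\<bar>LINT x|lborel. ((?\<eta> x *\<^sub>R (F (x + z) - F x)) \<bullet> e) * ((?\<eta> x *\<^sub>R (G (x + z) - G x)) \<bullet> rot e)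
          - ((?\<eta> x *\<^sub>R (F (x + z) - F x)) \<bullet> rot e) * ((?\<eta> x *\<^sub>R (G (x + z) - G x)) \<bullet> e)\<bar> \<le> (C1 + C2) * (Q * h)"
        by (rule wedge_integral_bound[OF e _ _ NF NG _ _ A(1) B(1) A(2) B(2) S2 S1, of c "2 * r"])
          (use out in auto)
      moreover have "((?\<eta> x *\<^sub>R (F (x + z) - F x)) \<bullet> e) * ((?\<eta> x *\<^sub>R (G (x + z) - G x)) \<bullet> rot e)
          - ((?\<eta> x *\<^sub>R (F (x + z) - F x)) \<bullet> rot e) * ((?\<eta> x *\<^sub>R (G (x + z) - G x)) \<bullet> e)
        = (?\<eta> x)\<^sup>2 * ((F (x + z) - F x) $ 1 * (G (x + z) - G x) $ 2
        - (F (x + z) - F x) $ 2 * (G (x + z) - G x) $ 1)" for x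
        unfolding wedge_frame[OF e, symmetric] by (simp add: power2_eq_square algebra_simps)
      ultimately show ?thesis by (simp add: h_def mult.assoc)
    qed simp
  qed
qed

section \<open>Coercivity on the unit circle\<close>

lemma Sigma_e: "Sigma_field e1 e2 z $ 1 = 4 / 3 * (z $ 2) ^ 3" "Sigma_field e1 e2 z $ 2 = 4 / 3 * (z $ 1) ^ 3"
  by (simp_all add: Sigma_field_def e1_def e2_def inner_vec2 axis_def)

lemma Sigma_eps:
  "Sigma_field eps1 eps2 z $ 1 = ((z $ 2 - z $ 1) ^ 3 - (z $ 1 + z $ 2) ^ 3) / 3"
  "Sigma_field eps1 eps2 z $ 2 = ((z $ 2 - z $ 1) ^ 3 + (z $ 1 + z $ 2) ^ 3) / 3"
proof -
  have c: "eps1 $ 1 = 1 / sqrt 2" "eps1 $ 2 = 1 / sqrt 2" "eps2 $ 1 = - 1 / sqrt 2" "eps2 $ 2 = 1 / sqrt 2"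
    by (simp_all add: eps1_def eps2_def e1_def e2_def axis_def)
  have i: "z \<bullet> eps1 = (z $ 1 + z $ 2) / sqrt 2" "z \<bullet> eps2 = (z $ 2 - z $ 1) / sqrt 2"
    by (simp_all add: inner_vec2 c field_simps)
  have s: "sqrt 2 ^ 3 * sqrt 2 = (4::real)"
    by (simp add: power3_eq_cube mult.assoc)
  have q: "(x / sqrt 2) ^ 3 * (1 / sqrt 2) = x ^ 3 / 4" for x :: real
    by (simp add: power_divide s)
  then have q': "(x / sqrt 2) ^ 3 * (- 1 / sqrt 2) = - (x ^ 3) / 4" for x :: real
    by simp
  show "Sigma_field eps1 eps2 z $ 1 = ((z $ 2 - z $ 1) ^ 3 - (z $ 1 + z $ 2) ^ 3) / 3"
    "Sigma_field eps1 eps2 z $ 2 = ((z $ 2 - z $ 1) ^ 3 + (z $ 1 + z $ 2) ^ 3) / 3"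
    unfolding Sigma_field_def vector_scaleR_component vector_add_component i c real_scaleR_def q q' by simp_all
qed

text \<open>In complex notation, for $|z| = 1$, the two fields are $i (\bar z + z^3 / 3)$ and $-\bar z + z^3 / 3$.
Hence the wedge of their increments is $|\Delta z|^2 - |\Delta z^3|^2 / 9$. With
$q = |\Delta z|^2$ one has $|\Delta z^3|^2 / 9 = q (1 - q/3)^2$, so the wedge equals
$\frac23 q^2 (1 - q/6)$, and $q \le 4$ gives the constant $\frac29$.\<close>
lemma wedge_coercive:
  fixes z w :: "real^2"
  assumes "norm z = 1" "norm w = 1"
  defines "a \<equiv> Sigma_field e1 e2 z - Sigma_field e1 e2 w"
    and "b \<equiv> Sigma_field eps1 eps2 z - Sigma_field eps1 eps2 w"
  shows "2 / 9 * norm (z - w) ^ 4 \<le> a $ 1 * b $ 2 - a $ 2 * b $ 1"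
proof -
  define x y s t where xy: "x = z $ 1" "y = z $ 2" "s = w $ 1" "t = w $ 2"
  have 1: "x\<^sup>2 + y\<^sup>2 = 1" "s\<^sup>2 + t\<^sup>2 = 1"
    using assms(1,2) by (simp_all add: norm_eq_1 inner_vec2 xy power2_eq_square)
  define q where "q = 2 - 2 * (x * s + y * t)"
  have nq: "norm (z - w) ^ 2 = q"
    unfolding power2_norm_eq_inner inner_vec2 using 1 by (simp add: xy q_def power2_eq_square algebra_simps)
  have n4: "norm (z - w) ^ 4 = q\<^sup>2" unfolding nq[symmetric] by simp
  have "norm (z - w) \<le> 2" using norm_triangle_ineq4[of z w] assms by simp
  then have "norm (z - w) ^ 2 \<le> 2 ^ 2" by (intro power_mono) auto
  then have q4: "q \<le> 4" using nq by simp
  have b: "((y - x) ^ 3 - (x + y) ^ 3) / 3 = - 2 * x + 4 / 3 * x ^ 3"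
      "((y - x) ^ 3 + (x + y) ^ 3) / 3 = 2 * y - 4 / 3 * y ^ 3"
      "((t - s) ^ 3 - (s + t) ^ 3) / 3 = - 2 * s + 4 / 3 * s ^ 3"
      "((t - s) ^ 3 + (s + t) ^ 3) / 3 = 2 * t - 4 / 3 * t ^ 3"
    using 1 by algebra+
  have "24 * ((y^3 - t^3) * (y - t) + (x^3 - s^3) * (x - s)) - 16 * ((y^3 - t^3)\<^sup>2 + (x^3 - s^3)\<^sup>2)
      = 6 * q\<^sup>2 - q^3"
    using 1 q_def by algebra
  moreover have "9 * (a $ 1 * b $ 2 - a $ 2 * b $ 1) =
      24 * ((y^3 - t^3) * (y - t) + (x^3 - s^3) * (x - s)) - 16 * ((y^3 - t^3)\<^sup>2 + (x^3 - s^3)\<^sup>2)"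
    unfolding a_def b_def vector_minus_component Sigma_e Sigma_eps xy[symmetric] b
    by (simp add: power2_eq_square algebra_simps)
  moreover have "q^3 \<le> 4 * q\<^sup>2"
    using mult_right_mono[OF q4, of "q\<^sup>2"] by (simp add: power3_eq_cube power2_eq_square mult.assoc)
  ultimately show ?thesis unfolding n4 by simp
qed

lemma Sigma_norm:
  assumes "norm \<alpha> = 1" "norm \<beta> = 1" "norm z \<le> 1"
  shows "norm (Sigma_field \<alpha> \<beta> z) \<le> 3"
proof -
  have c: "\<bar>z \<bullet> v\<bar> ^ 3 \<le> 1" if "norm v = 1" for v
    using Cauchy_Schwarz_ineq2[of z v] assms(3) that by (intro power_le_one) auto
  have "norm ((z \<bullet> \<beta>)^3 *\<^sub>R \<alpha> + (z \<bullet> \<alpha>)^3 *\<^sub>R \<beta>) \<le> 1 + 1"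
    using c[OF assms(1)] c[OF assms(2)] assms(1,2)
    by (intro order_trans[OF norm_triangle_ineq] add_mono) (auto simp: power_abs)
  then show ?thesis by (simp add: Sigma_field_def)
qed

lemma Sigma_measurable [measurable]: "Sigma_field \<alpha> \<beta> \<in> borel_measurable borel"
  unfolding Sigma_field_def[abs_def] by measurable

lemma component_measurable [measurable (raw)]:
  fixes f :: "'a \<Rightarrow> real^2"
  assumes "f \<in> borel_measurable M"
  shows "(\<lambda>x. f x $ i) \<in> borel_measurable M"
  using assms by (rule measurable_compose[where N = borel])
    (intro borel_measurable_continuous_onI continuous_intros)

lemma frame_norms: "norm e1 = 1" "norm e2 = 1" "norm eps1 = 1" "norm eps2 = 1"
proof -
  show "norm e1 = 1" "norm e2 = 1" "norm eps1 = 1" "norm eps2 = 1"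
    unfolding norm_eq_1 by (simp_all add: inner_vec2 eps1_def eps2_def e1_def e2_def axis_def)
qed

section \<open>Local and global estimates for the differences\<close>

text \<open>Fubini arguments need Borel measurability on the product, so $m$ is replaced by a Borel function
that is bounded everywhere and equals $m$ almost everywhere in $\Omega$.\<close>
lemma unit_field_Borel_version:
  fixes m :: "real^2 \<Rightarrow> real^2"
  assumes op: "open \<Omega>" and m: "m \<in> borel_measurable (lebesgue_on \<Omega>)"
    and 1: "AE x in lebesgue_on \<Omega>. norm (m x) = 1"
  obtains M where "M \<in> borel_measurable borel" "\<And>x. norm (M x) \<le> 1"
    "AE x in lborel. x \<in> \<Omega> \<longrightarrow> m x = M x \<and> norm (M x) = 1"
proof -
  have \<Omega>: "\<Omega> \<in> sets lebesgue" using op by simp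
  have "(\<lambda>x. if x \<in> \<Omega> then m x else 0) \<in> borel_measurable lebesgue"
    using m \<Omega> by (simp add: borel_measurable_if)
  then have "(\<lambda>x. (if x \<in> \<Omega> then m x else 0) $ i) \<in> borel_measurable lebesgue" for i
    by (rule component_measurable)
  from completion_ex_borel_measurable_real[OF this]
  have "\<forall>i. \<exists>g. g \<in> borel_measurable lborel \<and> (AE x in lborel. (if x \<in> \<Omega> then m x else 0) $ i = g x)"
    by blast
  from choice[OF this] obtain g where g: "\<And>i. g i \<in> borel_measurable lborel"
    "\<And>i. AE x in lborel. (if x \<in> \<Omega> then m x else 0) $ i = g i x" by blast
  have [measurable]: "g i \<in> borel_measurable borel" for i using g(1)[of i] by simp
  define G where "G x = g 1 x *\<^sub>R axis 1 1 + g 2 x *\<^sub>R (axis 2 1 :: real^2)" for x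
  have [measurable]: "G \<in> borel_measurable borel" unfolding G_def by measurable
  define M where "M x = (if norm (G x) \<le> 1 then G x else 0)" for x
  have "AE x in lebesgue. x \<in> \<Omega> \<longrightarrow> norm (m x) = 1"
    using 1 \<Omega> by (simp add: AE_restrict_space_iff)
  then have "AE x in lborel. x \<in> \<Omega> \<longrightarrow> norm (m x) = 1" by (simp add: AE_completion_iff)
  with g(2)[of 1] g(2)[of 2] have "AE x in lborel. x \<in> \<Omega> \<longrightarrow> m x = M x \<and> norm (M x) = 1"
  proof eventually_elim
    case (elim x)
    show ?case
    proof
      assume "x \<in> \<Omega>"
      then have "m x = G x" using elim by (simp add: vec_eq_iff forall_2 G_def axis_def)
      then show "m x = M x \<and> norm (M x) = 1" using elim \<open>x \<in> \<Omega>\<close> by (simp add: M_def)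
    qed
  qed
  moreover have "M \<in> borel_measurable borel" unfolding M_def by measurable
  moreover have "norm (M x) \<le> 1" for x by (simp add: M_def)
  ultimately show thesis using that by blast
qed

lemma AE_lborel_shift:
  fixes P :: "real^2 \<Rightarrow> bool"
  assumes "AE x in lborel. P x"
  shows "AE x in lborel. P (x + z)"
proof -
  have "AE x in distr lborel borel ((+) z). P x" unfolding lborel_distr_plus by (rule assms)
  then have "AE x in lborel. P (z + x)"
    by (rule AE_distrD[where M = lborel and M' = borel and f = "(+) z", rotated]) simp
  then show ?thesis by (simp add: add.commute)
qed

text \<open>On the inner ball of radius $r$ the cutoff is bounded below by a positive constant $p$, so the
quartic coercivity turns the linear bound for the wedge into one for the fourth power of the
difference of $m$.\<close>
lemma local_difference_estimate:
  fixes M m :: "real^2 \<Rightarrow> real^2"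
  assumes op: "open \<Omega>" and mm: "m \<in> borel_measurable (lebesgue_on \<Omega>)"
    and M[measurable]: "M \<in> borel_measurable borel" and M1: "\<And>x. norm (M x) \<le> 1"
    and Mm: "AE x in lborel. x \<in> \<Omega> \<longrightarrow> m x = M x \<and> norm (M x) = 1"
    and F: "distr_div \<Omega> (\<lambda>x. Sigma_field e1 e2 (m x)) \<in> M_loc \<Omega>"
    and G: "distr_div \<Omega> (\<lambda>x. Sigma_field eps1 eps2 (m x)) \<in> M_loc \<Omega>"
    and ball: "cball c (3 * r) \<subseteq> \<Omega>" and r: "0 < r"
  obtains C where "0 \<le> C" "\<And>z. norm z \<le> r \<Longrightarrow> norm z \<le> 1 \<Longrightarrow>
    (\<integral>\<^sup>+x. ennreal (indicator (ball c r) x * norm (M (x + z) - M x) ^ 4) \<partial>lborel) \<le> ennreal (C * norm z)"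
proof -
  let ?F = "\<lambda>x. Sigma_field e1 e2 (M x)" and ?G = "\<lambda>x. Sigma_field eps1 eps2 (M x)"
  let ?\<eta> = "bump c (2 * r)"
  have [measurable]: "?\<eta> \<in> borel_measurable borel" by (rule smooth_measurable[OF bump_smooth])
  have Fm: "(\<lambda>x. Sigma_field \<alpha> \<beta> (m x)) \<in> borel_measurable (lebesgue_on \<Omega>)" for \<alpha> \<beta>
    by (rule measurable_compose[OF mm Sigma_measurable])
  have FM: "(\<lambda>x. Sigma_field \<alpha> \<beta> (M x)) \<in> borel_measurable borel" for \<alpha> \<beta> by measurable
  have ae: "AE x in lborel. x \<in> \<Omega> \<longrightarrow> Sigma_field \<alpha> \<beta> (m x) = Sigma_field \<alpha> \<beta> (M x)" for \<alpha> \<beta>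
    using Mm by eventually_elim auto
  obtain \<Lambda>1 C1 where 1: "charge \<Lambda>1 C1"
    "\<And>\<phi>. smooth \<phi> \<Longrightarrow> (\<And>x. x \<notin> cball c (3 * r) \<Longrightarrow> \<phi> x = 0) \<Longrightarrow> (LINT x|lborel. ?F x \<bullet> grad \<phi> x) = - \<Lambda>1 \<phi>"
    by (rule divergence_charge[OF op F Fm FM ae ball]) blast
  obtain \<Lambda>2 C2 where 2: "charge \<Lambda>2 C2"
    "\<And>\<phi>. smooth \<phi> \<Longrightarrow> (\<And>x. x \<notin> cball c (3 * r) \<Longrightarrow> \<phi> x = 0) \<Longrightarrow> (LINT x|lborel. ?G x \<bullet> grad \<phi> x) = - \<Lambda>2 \<phi>"
    by (rule divergence_charge[OF op G Fm FM ae ball]) blast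
  have FK: "norm (?F x) \<le> 3" and GK: "norm (?G x) \<le> 3" for x
    using Sigma_norm frame_norms M1 by auto
  define W where "W z x = (?\<eta> x)\<^sup>2 * ((?F (x + z) - ?F x) $ 1 * (?G (x + z) - ?G x) $ 2
        - (?F (x + z) - ?F x) $ 2 * (?G (x + z) - ?G x) $ 1)" for z x
  obtain C where C: "0 \<le> C" "\<And>z. norm z \<le> r \<Longrightarrow> norm z \<le> 1 \<Longrightarrow> (LINT x|lborel. W z x) \<le> C * norm z"
    by (rule wedge_difference_bound[where c = c, OF FM FK FM GK 1(1) 2(1) 1(2) 2(2) r, folded W_def]) blast+
  define p where "p = flat_exp (3 * r\<^sup>2)"
  have p: "0 < p" using bump_lower(2)[of c c r] r by (simp add: p_def)
  show thesis
  proof (rule that[of "9 / 2 / p\<^sup>2 * C"])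
    show "0 \<le> 9 / 2 / p\<^sup>2 * C" using C by simp
    fix z :: "real^2" assume z: "norm z \<le> r" "norm z \<le> 1"
    have Wm[measurable]: "W z \<in> borel_measurable borel" unfolding W_def by measurable
    have Wi: "integrable lborel (W z)"
    proof (rule integrable_bounded_support[of _ 72 c "2 * r"])
      show "W z x = 0" if "x \<notin> cball c (2 * r)" for x
        using bump_outside[OF _ that] r by (simp add: W_def)
      show "\<bar>W z x\<bar> \<le> 72" for x
      proof -
        have cF: "\<bar>(?F (x + z) - ?F x) $ i\<bar> \<le> 6" for i
          using component_le_norm_cart[of "?F (x + z) - ?F x" i] norm_triangle_ineq4[of "?F (x + z)" "?F x"] FK[of x] FK[of "x + z"]
          by linarith
        have cG: "\<bar>(?G (x + z) - ?G x) $ i\<bar> \<le> 6" for i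
          using component_le_norm_cart[of "?G (x + z) - ?G x" i] norm_triangle_ineq4[of "?G (x + z)" "?G x"] GK[of x] GK[of "x + z"]
          by linarith
        have "\<bar>(?F (x + z) - ?F x) $ i * (?G (x + z) - ?G x) $ j\<bar> \<le> 6 * 6" for i j
          unfolding abs_mult by (intro mult_mono cF cG) auto
        from this[of 1 2] this[of 2 1]
        have "\<bar>(?F (x + z) - ?F x) $ 1 * (?G (x + z) - ?G x) $ 2 - (?F (x + z) - ?F x) $ 2 * (?G (x + z) - ?G x) $ 1\<bar> \<le> 72"
          by linarith
        moreover have "\<bar>(?\<eta> x)\<^sup>2\<bar> \<le> 1" using bump_nonneg bump_le_1 by (auto intro: power_le_one)
        ultimately have "\<bar>W z x\<bar> \<le> 1 * 72" unfolding W_def abs_mult by (intro mult_mono) auto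
        then show ?thesis by simp
      qed
    qed measurable
    have key: "AE x in lborel. 0 \<le> W z x \<and> indicator (ball c r) x * norm (M (x + z) - M x) ^ 4 \<le> 9 / 2 / p\<^sup>2 * W z x"
      using Mm AE_lborel_shift[OF Mm, of z]
    proof eventually_elim
      case (elim x)
      show ?case
      proof (cases "x \<in> cball c (2 * r)")
        case True
        have "dist c (x + z) \<le> dist c x + dist x (x + z)" by (rule dist_triangle)
        then have "x + z \<in> cball c (3 * r)" "x \<in> cball c (3 * r)" using True z r by (auto simp: dist_norm)
        then have "norm (M (x + z)) = 1" "norm (M x) = 1" using elim ball by auto
        note co = wedge_coercive[OF this]
        have W2: "(?\<eta> x)\<^sup>2 * (2 / 9 * norm (M (x + z) - M x) ^ 4) \<le> W z x"
          unfolding W_def by (intro mult_left_mono co) simp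
        moreover have "0 \<le> (?\<eta> x)\<^sup>2 * (2 / 9 * norm (M (x + z) - M x) ^ 4)" by simp
        ultimately have W0: "0 \<le> W z x" by linarith
        moreover have "indicator (ball c r) x * norm (M (x + z) - M x) ^ 4 \<le> 9 / 2 / p\<^sup>2 * W z x"
        proof (cases "x \<in> ball c r")
          case True
          have "p\<^sup>2 \<le> (?\<eta> x)\<^sup>2" using bump_lower(1)[OF True r] p by (intro power_mono) (auto simp: p_def)
          then have "p\<^sup>2 * (2 / 9 * norm (M (x + z) - M x) ^ 4) \<le> (?\<eta> x)\<^sup>2 * (2 / 9 * norm (M (x + z) - M x) ^ 4)"
            by (rule mult_right_mono) simp
          with W2 have "p\<^sup>2 * (2 / 9 * norm (M (x + z) - M x) ^ 4) \<le> W z x" by linarith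
          then show ?thesis using True p by (simp add: field_simps)
        qed (use W0 in simp)
        ultimately show ?thesis ..
      next
        case False
        then have "W z x = 0" "x \<notin> ball c r" using bump_outside[of "2 * r" x c] r by (auto simp: W_def)
        then show ?thesis by simp
      qed
    qed
    have "(\<integral>\<^sup>+x. ennreal (indicator (ball c r) x * norm (M (x + z) - M x) ^ 4) \<partial>lborel)
        \<le> (\<integral>\<^sup>+x. ennreal (9 / 2 / p\<^sup>2 * W z x) \<partial>lborel)"
    proof (rule nn_integral_mono_AE)
      show "AE x in lborel. ennreal (indicator (ball c r) x * norm (M (x + z) - M x) ^ 4) \<le> ennreal (9 / 2 / p\<^sup>2 * W z x)"
        using key by eventually_elim (rule ennreal_leI, blast)
    qed
    also have "\<dots> = ennreal (LINT x|lborel. 9 / 2 / p\<^sup>2 * W z x)"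
      using key Wi by (intro nn_integral_eq_integral) (auto elim!: eventually_mono)
    also have "\<dots> \<le> ennreal (9 / 2 / p\<^sup>2 * C * norm z)"
      using mult_left_mono[OF C(2)[OF z], of "9 / 2 / p\<^sup>2"] by (intro ennreal_leI) (simp add: mult.assoc)
    finally show "(\<integral>\<^sup>+x. ennreal (indicator (ball c r) x * norm (M (x + z) - M x) ^ 4) \<partial>lborel)
        \<le> ennreal (9 / 2 / p\<^sup>2 * C * norm z)" .
  qed
qed

text \<open>A finite cover of $\overline U$ by balls on which the local estimate holds settles small $z$. With $h$ the
minimum of $1$ and the radii, for $|z| > h$ the integrand is at most $16$ and the factor $|z| / h > 1$
absorbs the trivial bound.\<close>
lemma compact_difference_estimate:
  fixes m :: "real^2 \<Rightarrow> real^2"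
  assumes op: "open \<Omega>" and mm: "m \<in> borel_measurable (lebesgue_on \<Omega>)"
    and m1: "AE x in lebesgue_on \<Omega>. norm (m x) = 1"
    and F: "distr_div \<Omega> (\<lambda>x. Sigma_field e1 e2 (m x)) \<in> M_loc \<Omega>"
    and G: "distr_div \<Omega> (\<lambda>x. Sigma_field eps1 eps2 (m x)) \<in> M_loc \<Omega>"
    and U: "open U" "compact (closure U)" "closure U \<subseteq> \<Omega>"
  obtains C where "0 \<le> C" "\<And>z. norm z \<le> 1 \<Longrightarrow>
    (\<integral>\<^sup>+x. ennreal (norm (finite_diff U z m x) ^ 4) \<partial>lebesgue_on U) \<le> ennreal (C * norm z)"
proof -
  obtain M where M[measurable]: "M \<in> borel_measurable borel" and M1: "\<And>x. norm (M x) \<le> 1"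
    and Mm: "AE x in lborel. x \<in> \<Omega> \<longrightarrow> m x = M x \<and> norm (M x) = 1"
    using unit_field_Borel_version[OF op mm m1] by blast
  let ?d = "\<lambda>z x. norm (M (x + z) - M x) ^ 4"
  define Q where "Q c r C \<longleftrightarrow> 0 < r \<and> 0 \<le> C \<and> (\<forall>z. norm z \<le> r \<longrightarrow> norm z \<le> 1 \<longrightarrow>
      (\<integral>\<^sup>+x. ennreal (indicator (ball c r) x * ?d z x) \<partial>lborel) \<le> ennreal (C * norm z))" for c r C
  have "\<exists>r C. Q c r C" if c: "c \<in> closure U" for c
  proof -
    obtain e where e: "0 < e" "cball c e \<subseteq> \<Omega>"
      using op U(3) c open_contains_cball by blast
    have b: "cball c (3 * (e / 3)) \<subseteq> \<Omega>" "0 < e / 3" using e by auto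
    obtain C where "0 \<le> C" "\<And>z. norm z \<le> e / 3 \<Longrightarrow> norm z \<le> 1 \<Longrightarrow>
      (\<integral>\<^sup>+x. ennreal (indicator (ball c (e / 3)) x * ?d z x) \<partial>lborel) \<le> ennreal (C * norm z)"
      by (rule local_difference_estimate[OF op mm M M1 Mm F G b]) blast
    with b have "Q c (e / 3) C" unfolding Q_def by blast
    then show ?thesis by blast
  qed
  then obtain r K where Q: "\<And>c. c \<in> closure U \<Longrightarrow> Q c (r c) (K c)"
    by metis
  then have rK: "\<And>c. c \<in> closure U \<Longrightarrow> 0 < r c" "\<And>c. c \<in> closure U \<Longrightarrow> 0 \<le> K c"
    "\<And>c z. c \<in> closure U \<Longrightarrow> norm z \<le> r c \<Longrightarrow> norm z \<le> 1 \<Longrightarrow>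
      (\<integral>\<^sup>+x. ennreal (indicator (ball c (r c)) x * ?d z x) \<partial>lborel) \<le> ennreal (K c * norm z)"
    unfolding Q_def by blast+
  have cov: "closure U \<subseteq> (\<Union>c\<in>closure U. ball c (r c))" using rK(1) by force
  obtain D where D: "D \<subseteq> closure U" "finite D" "closure U \<subseteq> (\<Union>c\<in>D. ball c (r c))"
    by (rule compactE_image[OF U(2) _ cov]) auto
  define h where "h = Min (insert 1 (r ` D))"
  have h: "0 < h" "h \<le> 1" "\<And>c. c \<in> D \<Longrightarrow> h \<le> r c"
    using D rK(1) by (auto simp: h_def subset_iff)
  define C0 where "C0 = (\<Sum>c\<in>D. K c)"
  have C0: "0 \<le> C0" unfolding C0_def using D rK(2) by (intro sum_nonneg) auto
  have "bounded U" using U(2) by (meson bounded_subset closure_subset compact_imp_bounded)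
  then have "emeasure lborel U < \<infinity>" by (rule emeasure_bounded_finite)
  then obtain V where V: "0 \<le> V" "emeasure lborel U = ennreal V"
    by (cases "emeasure lborel U") auto
  have reduce: "(\<integral>\<^sup>+x. ennreal (norm (finite_diff U z m x) ^ 4) \<partial>lebesgue_on U)
      = (\<integral>\<^sup>+x. ennreal (if x \<in> U \<and> x + z \<in> U then ?d z x else 0) \<partial>lborel)" for z
  proof -
    have "(\<integral>\<^sup>+x. ennreal (norm (finite_diff U z m x) ^ 4) \<partial>lebesgue_on U)
        = (\<integral>\<^sup>+x. ennreal (norm (finite_diff U z m x) ^ 4) * indicator U x \<partial>lebesgue)"
      using U(1) by (intro nn_integral_restrict_space) auto
    also have "\<dots> = (\<integral>\<^sup>+x. ennreal (norm (finite_diff U z m x) ^ 4) * indicator U x \<partial>lborel)"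
      by (rule nn_integral_completion)
    also have "\<dots> = (\<integral>\<^sup>+x. ennreal (if x \<in> U \<and> x + z \<in> U then ?d z x else 0) \<partial>lborel)"
    proof (rule nn_integral_cong_AE)
      show "AE x in lborel. ennreal (norm (finite_diff U z m x) ^ 4) * indicator U x =
          ennreal (if x \<in> U \<and> x + z \<in> U then ?d z x else 0)"
        using Mm AE_lborel_shift[OF Mm, of z]
      proof eventually_elim
        case (elim x)
        have "U \<subseteq> \<Omega>" using U(3) closure_subset by blast
        with elim show ?case by (auto simp: finite_diff_def indicator_def)
      qed
    qed
    finally show ?thesis .
  qed
  have small: "(\<integral>\<^sup>+x. ennreal (norm (finite_diff U z m x) ^ 4) \<partial>lebesgue_on U) \<le> ennreal (C0 * norm z)"
    if z: "norm z \<le> h" for z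
  proof -
    have "(\<integral>\<^sup>+x. ennreal (norm (finite_diff U z m x) ^ 4) \<partial>lebesgue_on U)
        \<le> (\<integral>\<^sup>+x. (\<Sum>c\<in>D. ennreal (indicator (ball c (r c)) x * ?d z x)) \<partial>lborel)"
      unfolding reduce
    proof (rule nn_integral_mono)
      fix x
      show "ennreal (if x \<in> U \<and> x + z \<in> U then ?d z x else 0) \<le> (\<Sum>c\<in>D. ennreal (indicator (ball c (r c)) x * ?d z x))"
      proof (cases "x \<in> U")
        case True
        then obtain c where c: "c \<in> D" "x \<in> ball c (r c)" using D(3) closure_subset[of U] by blast
        have "ennreal (if x \<in> U \<and> x + z \<in> U then ?d z x else 0) \<le> ennreal (indicator (ball c (r c)) x * ?d z x)"
          using c by (intro ennreal_leI) auto
        also have "\<dots> \<le> (\<Sum>c\<in>D. ennreal (indicator (ball c (r c)) x * ?d z x))"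
          using c D(2) by (intro member_le_sum) auto
        finally show ?thesis .
      qed simp
    qed
    also have "\<dots> = (\<Sum>c\<in>D. \<integral>\<^sup>+x. ennreal (indicator (ball c (r c)) x * ?d z x) \<partial>lborel)"
    proof (rule nn_integral_sum)
      fix c
      have "indicat_real (ball c (r c)) \<in> borel_measurable borel"
        by (intro borel_measurable_indicator) simp
      moreover have "(\<lambda>x. ?d z x) \<in> borel_measurable borel" by measurable
      ultimately show "(\<lambda>x. ennreal (indicator (ball c (r c)) x * ?d z x)) \<in> borel_measurable lborel"
        by simp
    qed
    also have "\<dots> \<le> (\<Sum>c\<in>D. ennreal (K c * norm z))"
    proof (rule sum_mono)
      fix c assume c: "c \<in> D"
      then show "(\<integral>\<^sup>+x. ennreal (indicator (ball c (r c)) x * ?d z x) \<partial>lborel) \<le> ennreal (K c * norm z)"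
        using z h(2) h(3)[OF c] D(1) by (intro rK(3)) auto
    qed
    also have "\<dots> = ennreal (C0 * norm z)"
      unfolding C0_def sum_distrib_right using rK(2) D(1) by (intro sum_ennreal) (auto intro!: mult_nonneg_nonneg)
    finally show ?thesis .
  qed
  have large: "(\<integral>\<^sup>+x. ennreal (norm (finite_diff U z m x) ^ 4) \<partial>lebesgue_on U) \<le> ennreal (16 * V)" for z
  proof -
    have "?d z x \<le> 2 ^ 4" for x
      using norm_triangle_ineq4[of "M (x + z)" "M x"] M1[of x] M1[of "x + z"] by (intro power_mono) auto
    then have "(\<integral>\<^sup>+x. ennreal (norm (finite_diff U z m x) ^ 4) \<partial>lebesgue_on U) \<le> (\<integral>\<^sup>+x. ennreal 16 * indicator U x \<partial>lborel)"
      unfolding reduce by (intro nn_integral_mono) (auto intro!: ennreal_leI simp del: ennreal_numeral)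
    also have "\<dots> = ennreal (16 * V)"
      using U(1) V by (simp add: nn_integral_cmult_indicator ennreal_mult)
    finally show ?thesis .
  qed
  show thesis
  proof (rule that[of "C0 + 16 * V / h"])
    show "0 \<le> C0 + 16 * V / h" using C0 V h by simp
    fix z :: "real^2" assume "norm z \<le> 1"
    show "(\<integral>\<^sup>+x. ennreal (norm (finite_diff U z m x) ^ 4) \<partial>lebesgue_on U) \<le> ennreal ((C0 + 16 * V / h) * norm z)"
    proof (cases "norm z \<le> h")
      case True
      have "C0 * norm z \<le> (C0 + 16 * V / h) * norm z" using V h by (intro mult_right_mono) auto
      then show ?thesis using small[OF True] by (meson ennreal_leI order_trans)
    next
      case False
      then have "16 * V * h \<le> 16 * V * norm z" using V by (intro mult_left_mono) auto
      then have "16 * V \<le> 16 * V / h * norm z" using h by (simp add: field_simps)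
      also have "\<dots> \<le> (C0 + 16 * V / h) * norm z" using C0 by (intro mult_right_mono) auto
      finally show ?thesis using large[of z] by (meson ennreal_leI order_trans)
    qed
  qed
qed

lemma L4_norm_le:
  assumes "(\<integral>\<^sup>+x. ennreal (norm (f x) ^ 4) \<partial>lebesgue_on U) \<le> ennreal a" "0 \<le> a"
  shows "L4_norm U f \<le> ennreal (root 4 a)"
proof -
  let ?I = "\<integral>\<^sup>+x. ennreal (norm (f x) ^ 4) \<partial>lebesgue_on U"
  have "?I \<noteq> \<infinity>" using assms(1) by (auto simp: top_unique)
  moreover have "enn2real ?I \<le> a"
    using enn2real_mono[OF assms(1)] assms(2) by simp
  ultimately show ?thesis by (simp add: L4_norm_def Let_def ennreal_leI)
qed

theorem proposition4p3:
  fixes \<Omega> :: "(real^2) set" and m :: "real^2 \<Rightarrow> real^2"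
  assumes "bounded_lipschitz_domain \<Omega>"
    and "m \<in> borel_measurable (lebesgue_on \<Omega>)"
    and "AE x in lebesgue_on \<Omega>. norm (m x) = 1"
    and "\<forall>\<phi>\<in>test_functions \<Omega>. distr_div \<Omega> m \<phi> = 0"
    and "distr_div \<Omega> (\<lambda>x. Sigma_field e1 e2 (m x)) \<in> M_loc \<Omega>"
    and "distr_div \<Omega> (\<lambda>x. Sigma_field eps1 eps2 (m x)) \<in> M_loc \<Omega>"
  shows "\<forall>s. 0 < s \<and> s < 1/4 \<longrightarrow> m \<in> besov_4_inf_loc s \<Omega>"
proof (intro allI impI)
  fix s :: real assume s: "0 < s \<and> s < 1/4"
  have op: "open \<Omega>" using assms(1) by (simp add: bounded_lipschitz_domain_def)
  have "m \<in> besov_4_inf s U" if U: "open U" "compact (closure U)" "closure U \<subseteq> \<Omega>" for U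
  proof -
    have U\<Omega>: "U \<subseteq> \<Omega>" using U(3) closure_subset by blast
    have mU: "m \<in> borel_measurable (lebesgue_on U)"
      using assms(2) U\<Omega> by (rule measurable_restrict_mono)
    have "L4_norm U m < \<infinity>"
    proof -
      have "bounded U" using U(2) by (meson bounded_subset closure_subset compact_imp_bounded)
      then have "emeasure lborel U < \<infinity>" by (rule emeasure_bounded_finite)
      then obtain V where V: "0 \<le> V" "emeasure lborel U = ennreal V"
        by (cases "emeasure lborel U") auto
      have "AE x in lebesgue. x \<in> \<Omega> \<longrightarrow> norm (m x) = 1"
        using assms(3) op by (simp add: AE_restrict_space_iff)
      then have "AE x in lebesgue. x \<in> U \<longrightarrow> norm (m x) = 1"
        using U\<Omega> by (auto elim!: eventually_mono)
      then have "AE x in lebesgue_on U. norm (m x) = 1"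
        using U(1) by (simp add: AE_restrict_space_iff)
      then have "(\<integral>\<^sup>+x. ennreal (norm (m x) ^ 4) \<partial>lebesgue_on U) = (\<integral>\<^sup>+x. 1 \<partial>lebesgue_on U)"
        by (intro nn_integral_cong_AE) (auto elim!: eventually_mono)
      also have "\<dots> = ennreal V"
        using U(1) V by (simp add: emeasure_restrict_space space_restrict_space)
      finally have "L4_norm U m \<le> ennreal (root 4 V)" using V by (intro L4_norm_le) auto
      then show ?thesis using ennreal_less_top by (auto intro: le_less_trans)
    qed
    moreover have "(SUP t\<in>{0<..1}. ennreal (t powr - s) *
        (SUP z\<in>{z. norm z \<le> t}. L4_norm U (finite_diff U z m))) < \<infinity>"
    proof -
      obtain C where C: "0 \<le> C" "\<And>z. norm z \<le> 1 \<Longrightarrow>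
          (\<integral>\<^sup>+x. ennreal (norm (finite_diff U z m x) ^ 4) \<partial>lebesgue_on U) \<le> ennreal (C * norm z)"
        using compact_difference_estimate[OF op assms(2,3,5,6) U] by blast
      have "(SUP t\<in>{0<..1}. ennreal (t powr - s) *
        (SUP z\<in>{z. norm z \<le> t}. L4_norm U (finite_diff U z m))) \<le> ennreal (root 4 C)"
      proof (rule SUP_least)
        fix t :: real assume t: "t \<in> {0<..1}"
        have "(SUP z\<in>{z. norm z \<le> t}. L4_norm U (finite_diff U z m)) \<le> ennreal (root 4 (C * t))"
        proof (rule SUP_least)
          fix z :: "real^2" assume z: "z \<in> {z. norm z \<le> t}"
          have "L4_norm U (finite_diff U z m) \<le> ennreal (root 4 (C * norm z))"
            using z t C by (intro L4_norm_le) auto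
          also have "\<dots> \<le> ennreal (root 4 (C * t))"
            using z C by (intro ennreal_leI) (simp add: mult_left_mono)
          finally show "L4_norm U (finite_diff U z m) \<le> ennreal (root 4 (C * t))" .
        qed
        then have "ennreal (t powr - s) * (SUP z\<in>{z. norm z \<le> t}. L4_norm U (finite_diff U z m))
            \<le> ennreal (t powr - s) * ennreal (root 4 (C * t))"
          by (rule mult_left_mono) simp
        also have "\<dots> = ennreal (t powr - s * root 4 (C * t))"
          using t C by (simp add: ennreal_mult)
        also have "t powr - s * root 4 (C * t) = root 4 C * (t powr (1/4 - s))"
        proof -
          have "root 4 t = t powr (1/4)" using t by (simp add: root_powr_inverse)
          moreover have "t powr (1/4 - s) = t powr (1/4) * t powr - s" by (simp add: powr_add[symmetric])
          ultimately show ?thesis by (simp add: real_root_mult)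
        qed
        also have "ennreal (root 4 C * (t powr (1/4 - s))) \<le> ennreal (root 4 C * 1)"
          using t s C by (intro ennreal_leI mult_left_mono powr_le1) auto
        finally show "ennreal (t powr - s) * (SUP z\<in>{z. norm z \<le> t}. L4_norm U (finite_diff U z m)) \<le> ennreal (root 4 C)"
          by simp
      qed
      then show ?thesis using ennreal_less_top by (auto intro: le_less_trans)
    qed
    ultimately show ?thesis using mU by (simp add: besov_4_inf_def)
  qed
  then show "m \<in> besov_4_inf_loc s \<Omega>" by (auto simp: besov_4_inf_loc_def)
qed

end
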